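(* Let $B_1,B_2$ be independent standard one-dimensional Brownian motions with $B_j(0)=0$, let $x>0$, $0\le y\le x$, $v\in\mathbb{R}$, $K>0$, and let $L_1,L_2,X_1,X_2,Y,V,T_\infty$ be the processes and the random time described in the context. Then $P(T_\infty=\infty)=1$.
   Context: $L_1,L_2$ and the random time $T_\infty$ are the unique ones satisfying: (1) $X_1(t)\le Y(t)\le X_2(t)$ for $0\le t\le T_\infty$, where $X_1(t)=B_1(t)-L_1(t)$, $X_2(t)=x+B_2(t)+L_2(t)$, $V(t)=v+K(L_1(t)-L_2(t))$, $Y(t)=y+\int_0^tV(s)\,ds$; (2) $L_1,L_2$ are continuous, nondecreasing, with $L_1(0)=L_2(0)=0$; (3) $L_1$ and $L_2$ are flat off $\{t:X_1(t)=Y(t)\}$ and $\{t:X_2(t)=Y(t)\}$ respectively (that is, the measures $dL_1$, $dL_2$ give no mass to the complements of these sets); (4) $T_\infty=\inf\{t:X_1(t)=X_2(t)\}$ (with $\inf\emptyset=\infty$). The processes are considered up to time $T_\infty$. *)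

theory Defs
  imports "HOL-Probability.Probability"
begin

text \<open>Standard one-dimensional Brownian motion with time set [0,\<open>\<infinity>\<close>), started at 0; the values of
  \<open>B\<close> at negative times are irrelevant. The start at 0 and the continuity of paths are only required
  almost surely.\<close>

definition (in prob_space) brownian_motion :: "(real \<Rightarrow> 'a \<Rightarrow> real) \<Rightarrow> bool" where
  "brownian_motion B \<longleftrightarrow>
     (\<forall>t\<ge>0. random_variable borel (B t)) \<and>
     (AE \<omega> in M. B 0 \<omega> = 0) \<and>
     (\<forall>(n::nat) (t::nat \<Rightarrow> real). 0 \<le> t 0 \<longrightarrow> (\<forall>i<n. t i \<le> t (Suc i)) \<longrightarrow>
        indep_vars (\<lambda>_. borel) (\<lambda>i \<omega>. B (t (Suc i)) \<omega> - B (t i) \<omega>) {..<n}) \<and>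
     (\<forall>s t. 0 \<le> s \<longrightarrow> s < t \<longrightarrow>
        distributed M lborel (\<lambda>\<omega>. B t \<omega> - B s \<omega>) (\<lambda>z. ennreal (normal_density 0 (sqrt (t - s)) z))) \<and>
     (AE \<omega> in M. continuous_on {0..} (\<lambda>t. B t \<omega>))"

text \<open>Independence of whole processes, that is, of the induced random elements of the product space
  of real functions on [0,\<open>\<infinity>\<close>).\<close>

definition (in prob_space) indep_processes ::
    "(real \<Rightarrow> 'a \<Rightarrow> real) \<Rightarrow> (real \<Rightarrow> 'a \<Rightarrow> real) \<Rightarrow> bool" where
  "indep_processes A B \<longleftrightarrow>
     indep_var (PiM {0..} (\<lambda>_. borel)) (\<lambda>\<omega>. \<lambda>t\<in>{0..}. A t \<omega>)
               (PiM {0..} (\<lambda>_. borel)) (\<lambda>\<omega>. \<lambda>t\<in>{0..}. B t \<omega>)"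

text \<open>Everything below is for a single path: \<open>b1\<close>, \<open>b2\<close> are the driving paths, \<open>l1\<close>, \<open>l2\<close> the
  pushing terms and \<open>\<tau>\<close> the (possibly infinite) end of the time interval.\<close>

definition path_X1 :: "(real \<Rightarrow> real) \<Rightarrow> (real \<Rightarrow> real) \<Rightarrow> real \<Rightarrow> real" where
  "path_X1 b1 l1 t = b1 t - l1 t"

definition path_X2 :: "real \<Rightarrow> (real \<Rightarrow> real) \<Rightarrow> (real \<Rightarrow> real) \<Rightarrow> real \<Rightarrow> real" where
  "path_X2 x b2 l2 t = x + b2 t + l2 t"

definition path_V :: "real \<Rightarrow> real \<Rightarrow> (real \<Rightarrow> real) \<Rightarrow> (real \<Rightarrow> real) \<Rightarrow> real \<Rightarrow> real" where
  "path_V v K l1 l2 t = v + K * (l1 t - l2 t)"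

definition path_Y ::
    "real \<Rightarrow> real \<Rightarrow> real \<Rightarrow> (real \<Rightarrow> real) \<Rightarrow> (real \<Rightarrow> real) \<Rightarrow> real \<Rightarrow> real" where
  "path_Y y v K l1 l2 t = y + integral {0..t} (path_V v K l1 l2)"

definition times_upto :: "ereal \<Rightarrow> real set" where
  "times_upto \<tau> = {t. 0 \<le> t \<and> ereal t \<le> \<tau>}"

definition stopped_path :: "ereal \<Rightarrow> (real \<Rightarrow> real) \<Rightarrow> real \<Rightarrow> real" where
  "stopped_path \<tau> l t = l (real_of_ereal (min (ereal (max 0 t)) \<tau>))"

text \<open>The measure \<open>dl\<close> on the time interval is the Lebesgue--Stieltjes measure of \<open>l\<close> extended to all
  of \<open>\<real>\<close> as a constant outside of \<^term>\<open>times_upto \<tau>\<close>. It is only meaningful for \<open>l\<close> continuous and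
  nondecreasing on that interval.\<close>

definition flat_off :: "ereal \<Rightarrow> (real \<Rightarrow> real) \<Rightarrow> real set \<Rightarrow> bool" where
  "flat_off \<tau> l A \<longleftrightarrow> times_upto \<tau> - A \<in> null_sets (interval_measure (stopped_path \<tau> l))"

text \<open>All functions are only looked at on \<^term>\<open>times_upto \<tau>\<close>; in particular, in the last clause the
  infimum ranges over times at which the processes are still defined. That clause also forces
  \<open>0 \<le> \<tau>\<close>, since the infimum of the empty set is \<open>\<infinity>\<close>.\<close>

definition path_solution ::
    "real \<Rightarrow> real \<Rightarrow> real \<Rightarrow> real \<Rightarrow> (real \<Rightarrow> real) \<Rightarrow> (real \<Rightarrow> real) \<Rightarrow>
     (real \<Rightarrow> real) \<Rightarrow> (real \<Rightarrow> real) \<Rightarrow> ereal \<Rightarrow> bool" where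
  "path_solution x y v K b1 b2 l1 l2 \<tau> \<longleftrightarrow>
     (let X1 = path_X1 b1 l1; X2 = path_X2 x b2 l2; Y = path_Y y v K l1 l2; I = times_upto \<tau> in
        (\<forall>t\<in>I. X1 t \<le> Y t \<and> Y t \<le> X2 t) \<and>
        continuous_on I l1 \<and> mono_on I l1 \<and> l1 0 = 0 \<and>
        continuous_on I l2 \<and> mono_on I l2 \<and> l2 0 = 0 \<and>
        flat_off \<tau> l1 {t. X1 t = Y t} \<and>
        flat_off \<tau> l2 {t. X2 t = Y t} \<and>
        \<tau> = (INF t\<in>{t\<in>I. X1 t = X2 t}. ereal t))"

end

theory Submission
  imports Defs
begin

text \<open>Suppose that \<open>T < \<infinity>\<close> on some path. At that time \<open>X1 = Y = X2\<close>, and since \<open>V\<close> is continuous on the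
compact interval \<open>[0, T]\<close> it is bounded there by some \<open>C\<close>, so that \<open>Y\<close> is \<open>C\<close>-Lipschitz. Because \<open>L1\<close> is
nondecreasing, \<open>B1 s \<le> Y s + L1 s \<le> Y s + L1 T = B1 T + Y s - Y T\<close> for \<open>s \<le> T\<close>, hence
\<open>B1 t + C t\<close> attains its running maximum over \<open>[0, T]\<close> at time \<open>T\<close>. In the same way \<open>C t - B2 t\<close>
attains its running maximum at \<open>T\<close>. Moreover the two values are at least \<open>y\<close> and \<open>x - y\<close>, and these
are not both zero. This is \<open>simultaneous_record_of_collision\<close>; it reduces the theorem to a statement
about two independent Brownian motions with the same constant drift \<open>C\<close>: almost surely, they have no
simultaneous record (\<open>AE_no_simultaneous_record\<close>). Letting \<open>C\<close> and the time horizon range over the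
natural numbers covers the random bound and the random time.

The distances of two Brownian motions from their running maxima form a normally reflected planar
Brownian motion in the quadrant, and a simultaneous record is a visit to the corner. The corner is
polar for the same reason for which points are polar in the plane: the function \<open>- ln r\<close> of the
distance \<open>r\<close> from the corner is harmonic, satisfies the Neumann condition on both sides, and is infinite
at the corner. The drift adds at most a multiple of \<open>1 / r\<close> to the generator, and this is compensated by
subtracting a large multiple of \<open>r\<close>.

No stochastic calculus is used. On a grid of mesh \<open>\<delta> = \<sigma>\<^sup>2\<close> the distances from the running maxima
follow the recursion \<open>u' = max 0 (u - p)\<close> with independent Gaussian increments \<open>p\<close>. With
\<open>r = sqrt (u\<^sup>2 + v\<^sup>2 + e\<^sup>2)\<close>, the function \<open>u\<^sup>2 + v\<^sup>2 - ln r - 4 C r - (u + v)\<close> grows in mean by at most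
\<open>const * \<delta> + K e * \<sigma> ^ 3\<close> in one step (\<open>expected_potential_step\<close>), where the first constant does not
depend on the cutoff \<open>e\<close>. This function is bounded below, uniformly in \<open>e\<close>, and is at least
\<open>ln (1 / (2 e))\<close> up to a constant when both coordinates are at most \<open>e\<close>. Stopping the chain upon its
arrival in that square and using Markov's inequality bounds the probability of the arrival by
\<open>(const + o(1)) / ln (1 / (2 e))\<close> as \<open>\<delta> \<rightarrow> 0\<close> for fixed \<open>e\<close> (\<open>prob_chain_near_corner\<close>). By continuity
of the paths, a simultaneous record forces the arrival for all sufficiently fine grids
(\<open>chain_near_corner_of_record\<close>), for each \<open>e\<close>. Finally \<open>e \<rightarrow> 0\<close>. Taking the limits in this order means that
continuity of the paths suffices, without any modulus.\<close>

section \<open>Expansions of the logarithm and the radius\<close>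

text \<open>This bound and \<open>ln_cubic_lower_bound\<close> expand \<open>s\<close> and \<open>ln s\<close> in powers of \<open>s\<^sup>2 - 1\<close> rather than of
\<open>s - 1\<close>: in the application \<open>s\<close> is a quotient of two radii, and it is the increment of the squared radius
that is a polynomial in the Gaussian increments.\<close>

lemma sqrt_cubic_lower_bound:
  fixes s :: real assumes "0 \<le> s"
  shows "1 + (s\<^sup>2 - 1) / 2 - (s\<^sup>2 - 1)\<^sup>2 / 8 - \<bar>s - 1\<bar> ^ 3 / 2 \<le> s"
proof -
  have id: "s - 1 - (s\<^sup>2 - 1) / 2 + (s\<^sup>2 - 1)\<^sup>2 / 8 = (s - 1) ^ 3 * (s + 3) / 8"
    by (simp add: field_simps power2_eq_square power3_eq_cube)
  have "- (\<bar>s - 1\<bar> ^ 3 / 2) \<le> (s - 1) ^ 3 * (s + 3) / 8"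
  proof (cases "1 \<le> s")
    case True
    then have "0 \<le> (s - 1) ^ 3 * (s + 3) / 8" by simp
    moreover have "0 \<le> \<bar>s - 1\<bar> ^ 3" by simp
    ultimately show ?thesis by linarith
  next
    case False
    then have "(1 - s) ^ 3 * (s + 3) \<le> (1 - s) ^ 3 * 4" by (intro mult_left_mono) auto
    moreover have "(s - 1) ^ 3 = - ((1 - s) ^ 3)" by (simp add: power3_eq_cube algebra_simps)
    moreover have "\<bar>s - 1\<bar> = 1 - s" using False by simp
    ultimately show ?thesis by (simp add: mult.commute)
  qed
  with id show ?thesis by linarith
qed

lemma ln_cubic_lower_bound:
  fixes s :: real assumes "1 / 2 \<le> s"
  shows "(s\<^sup>2 - 1) / 2 - (s\<^sup>2 - 1)\<^sup>2 / 4 - 2 * \<bar>s - 1\<bar> ^ 3 \<le> ln s"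
proof -
  define g where "g s = ln s - ((s\<^sup>2 - 1) / 2 - (s\<^sup>2 - 1)\<^sup>2 / 4)" for s :: real
  have der: "(g has_real_derivative (s\<^sup>2 - 1)\<^sup>2 / s) (at s)" if "0 < s" for s
    unfolding g_def using that
    by (auto intro!: derivative_eq_intros simp: field_simps power2_eq_square power3_eq_cube)
  show ?thesis
  proof (cases "1 \<le> s")
    case True
    have "g 1 \<le> g s"
    proof (rule DERIV_nonneg_imp_nondecreasing[OF True])
      fix t :: real assume "1 \<le> t"
      then show "\<exists>y. (g has_real_derivative y) (at t) \<and> 0 \<le> y"
        by (intro exI[of _ "(t\<^sup>2 - 1)\<^sup>2 / t"] conjI der) auto
    qed
    moreover have "0 \<le> \<bar>s - 1\<bar> ^ 3" by simp
    moreover have "g 1 = 0" by (simp add: g_def)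
    ultimately show ?thesis unfolding g_def by linarith
  next
    case False
    define k where "k s = g s + 2 * (1 - s) ^ 3" for s :: real
    have "\<exists>y. (k has_real_derivative y) (at t) \<and> y \<le> 0" if "s \<le> t" "t \<le> 1" for t
    proof -
      have t: "1 / 2 \<le> t" using assms that by simp
      have "0 \<le> (2 - t) * (2 * t - 1)" using that t by (intro mult_nonneg_nonneg) auto
      then have "(t + 1)\<^sup>2 \<le> 6 * t" using t by (simp add: power2_eq_square algebra_simps)
      then have "(t + 1)\<^sup>2 / t - 6 \<le> 0" using t by (simp add: field_simps)
      then have "(1 - t)\<^sup>2 * ((t + 1)\<^sup>2 / t - 6) \<le> 0"
        by (simp add: mult_nonneg_nonpos)
      moreover have "(1 - t)\<^sup>2 * ((t + 1)\<^sup>2 / t - 6) = (t\<^sup>2 - 1)\<^sup>2 / t - 6 * (1 - t)\<^sup>2"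
        using t by (simp add: field_simps power2_eq_square)
      moreover have "(k has_real_derivative (t\<^sup>2 - 1)\<^sup>2 / t - 6 * (1 - t)\<^sup>2) (at t)"
        unfolding k_def
        by (rule derivative_eq_intros der refl | use t in simp)+
      ultimately show ?thesis by auto
    qed
    then have "k 1 \<le> k s"
      by (intro DERIV_nonpos_imp_nonincreasing[of s 1 k]) (use False in auto)
    moreover have "\<bar>s - 1\<bar> = 1 - s" using False by simp
    ultimately show ?thesis unfolding k_def g_def by simp
  qed
qed

lemma sqrt_sum_squares_lipschitz:
  fixes a b a' b' c :: real
  shows "\<bar>sqrt (a'\<^sup>2 + b'\<^sup>2 + c\<^sup>2) - sqrt (a\<^sup>2 + b\<^sup>2 + c\<^sup>2)\<bar> \<le> \<bar>a' - a\<bar> + \<bar>b' - b\<bar>"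
proof -
  have n: "sqrt (a\<^sup>2 + b\<^sup>2 + c\<^sup>2) = norm ((a, b, c) :: real \<times> real \<times> real)" for a b
    by (simp add: norm_prod_def add.assoc)
  have "norm ((a' - a, b' - b, 0) :: real \<times> real \<times> real) \<le> \<bar>a' - a\<bar> + \<bar>b' - b\<bar>"
    using sqrt_sum_squares_le_sum_abs[of "a' - a" "b' - b"] by (simp add: norm_prod_def)
  moreover have "\<bar>norm ((a', b', c) :: real \<times> real \<times> real) - norm (a, b, c)\<bar>
      \<le> norm ((a', b', c) - (a, b, c) :: real \<times> real \<times> real)"
    by (rule norm_triangle_ineq3)
  ultimately show ?thesis by (simp add: n)
qed

text \<open>The error terms do not involve \<open>r\<close>. This works for a small ratio \<open>r' / r\<close> too, because a substantial
relative decrease of a radius that stays above \<open>e\<close> requires that \<open>h\<close> is at least of the order of \<open>e\<close>.\<close>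

lemma
  fixes r r' h e :: real
  assumes "0 < e" "e \<le> r" "e \<le> r'" "\<bar>r' - r\<bar> \<le> h"
  defines "D \<equiv> r'\<^sup>2 - r\<^sup>2"
  shows ln_increment: "ln r + D / (2 * r\<^sup>2) - D\<^sup>2 / (4 * r ^ 4) - 8 * (h / e) ^ 3 \<le> ln r'"
    and radius_increment: "r + D / (2 * r) - D\<^sup>2 / (8 * r ^ 3) - h ^ 3 / (2 * e\<^sup>2) \<le> r'"
proof -
  define s where "s = r' / r"
  have pos: "0 < r" "0 < r'" "0 \<le> h" "0 < s" using assms by (auto simp: s_def)
  have D: "D = r\<^sup>2 * (s\<^sup>2 - 1)" using pos by (simp add: D_def s_def field_simps power2_eq_square)
  have r': "r' = r * s" using pos by (simp add: s_def)
  have s1: "\<bar>s - 1\<bar> \<le> h / r"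
  proof -
    have "s - 1 = (r' - r) / r" using pos by (simp add: s_def field_simps)
    then have "\<bar>s - 1\<bar> = \<bar>r' - r\<bar> / r" using pos by simp
    then show ?thesis using assms(4) pos by (simp add: divide_right_mono)
  qed
  have he: "h / r \<le> h / e" using assms pos by (intro divide_left_mono) auto
  have c1: "D / (2 * r\<^sup>2) = (s\<^sup>2 - 1) / 2" "D\<^sup>2 / (4 * r ^ 4) = (s\<^sup>2 - 1)\<^sup>2 / 4"
    using pos by (simp_all add: D field_simps power2_eq_square power4_eq_xxxx)
  have lnr: "ln r' = ln r + ln s" using pos by (simp add: r' ln_mult)
  have "(s\<^sup>2 - 1) / 2 - (s\<^sup>2 - 1)\<^sup>2 / 4 - 8 * (h / e) ^ 3 \<le> ln s"
  proof (cases "1 / 2 \<le> s")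
    case True
    have "\<bar>s - 1\<bar> ^ 3 \<le> (h / e) ^ 3" by (rule power_mono) (use s1 he in auto)
    moreover have "0 \<le> (h / e) ^ 3" using pos assms by simp
    ultimately show ?thesis using ln_cubic_lower_bound[OF True] by linarith
  next
    case False
    have half: "1 / 2 \<le> h / r" using s1 False by linarith
    have he2: "1 / 2 \<le> h / e" using half he by linarith
    \<comment> \<open>Here the bound comes from \<open>r' \<ge> e\<close>: the radius can only shrink by a large factor if \<open>h\<close> is
      comparable to \<open>r\<close>.\<close>
    have "ln (1 / s) \<le> 1 / s - 1" using pos by (intro ln_le_minus_one) simp
    then have "- (1 / s) \<le> ln s" using pos by (simp add: ln_div)
    moreover have "1 / s \<le> r / e" using pos assms by (simp add: s_def divide_left_mono)
    moreover have "r / e \<le> 2 * (h / e)" using half pos assms by (simp add: field_simps)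
    moreover have "2 * (h / e) \<le> 8 * (h / e) ^ 3"
    proof -
      have *: "2 * k \<le> 8 * k ^ 3" if "1 / 2 \<le> k" for k :: real
      proof -
        have "(1 / 2)\<^sup>2 \<le> k\<^sup>2" using that by (intro power_mono) auto
        then have "2 * k * 1 \<le> 2 * k * (4 * k\<^sup>2)"
          using that by (intro mult_left_mono) (auto simp: power2_eq_square)
        then show ?thesis by (simp add: power2_eq_square power3_eq_cube mult_ac)
      qed
      show ?thesis by (rule *[OF he2])
    qed
    moreover have "(s\<^sup>2 - 1) / 2 \<le> 0" using False pos by (simp add: power2_eq_square mult_le_one)
    moreover have "0 \<le> (s\<^sup>2 - 1)\<^sup>2 / 4" by simp
    ultimately show ?thesis by linarith
  qed
  then show "ln r + D / (2 * r\<^sup>2) - D\<^sup>2 / (4 * r ^ 4) - 8 * (h / e) ^ 3 \<le> ln r'"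
    unfolding c1 lnr by simp
  have c2: "D / (2 * r) = r * ((s\<^sup>2 - 1) / 2)" "D\<^sup>2 / (8 * r ^ 3) = r * ((s\<^sup>2 - 1)\<^sup>2 / 8)"
    using pos by (simp_all add: D field_simps power2_eq_square power3_eq_cube)
  have "r * \<bar>s - 1\<bar> ^ 3 \<le> r * (h / r) ^ 3" using s1 pos by (intro mult_left_mono power_mono) auto
  also have "\<dots> = h ^ 3 / r\<^sup>2" using pos by (simp add: field_simps power2_eq_square power3_eq_cube)
  also have "\<dots> \<le> h ^ 3 / e\<^sup>2" using assms pos by (intro divide_left_mono power_mono) auto
  finally have "r * (\<bar>s - 1\<bar> ^ 3 / 2) \<le> h ^ 3 / (2 * e\<^sup>2)" by simp
  moreover have "r * (1 + (s\<^sup>2 - 1) / 2 - (s\<^sup>2 - 1)\<^sup>2 / 8 - \<bar>s - 1\<bar> ^ 3 / 2) \<le> r * s"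
    using sqrt_cubic_lower_bound pos by (intro mult_left_mono) auto
  ultimately show "r + D / (2 * r) - D\<^sup>2 / (8 * r ^ 3) - h ^ 3 / (2 * e\<^sup>2) \<le> r'"
    unfolding c2 r' by (simp add: algebra_simps)
qed

section \<open>The Lyapunov function of the reflected walk\<close>

text \<open>The cutoff \<open>e\<close> makes the logarithm finite and its derivatives bounded; the radius remains a smooth
even function of each coordinate, so that it satisfies the Neumann condition on both sides of the
quadrant.\<close>

definition radius :: "real \<Rightarrow> real \<Rightarrow> real \<Rightarrow> real" where
  "radius e u v = sqrt (u\<^sup>2 + v\<^sup>2 + e\<^sup>2)"

text \<open>Each term has its own task. The logarithm detects the corner. The multiple of the radius, whose
Laplacian is of order \<open>1 / r\<close>, absorbs the effect of the drift on the logarithm. The term \<open>- (u + v)\<close>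
decreases by the amount of each push at the boundary and thereby pays for the error that a push of
positive size causes in the other terms. The squares dominate the negative terms of linear growth.\<close>

definition lyapunov :: "real \<Rightarrow> real \<Rightarrow> real \<Rightarrow> real \<Rightarrow> real" where
  "lyapunov C e u v = u\<^sup>2 + v\<^sup>2 - ln (radius e u v) - 4 * C * radius e u v - (u + v)"

lemma radius_bounds:
  assumes "0 < e" "0 \<le> u" "0 \<le> v"
  shows "e \<le> radius e u v" "u \<le> radius e u v" "v \<le> radius e u v" "0 < radius e u v"
    "radius e u v \<le> u + v + e"
proof -
  show e: "e \<le> radius e u v" and "u \<le> radius e u v" "v \<le> radius e u v"
    unfolding radius_def by (rule real_le_rsqrt; simp)+
  then show "0 < radius e u v" using assms by linarith
  show "radius e u v \<le> u + v + e"
    unfolding radius_def using assms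
    by (intro real_le_lsqrt) (auto simp: power2_eq_square algebra_simps)
qed

text \<open>The trade-off for a push of size \<open>z\<close>: its quadratic cost minus the gain from \<open>- (u + v)\<close> is of third
order, hence negligible when it is summed over \<open>1 / \<sigma>\<^sup>2\<close> steps.\<close>

lemma quadratic_minus_linear_le: "c * z\<^sup>2 - z \<le> c\<^sup>2 * z ^ 3" if "0 \<le> c" "0 \<le> z" for c z :: real
proof -
  have "0 \<le> z * ((c * z - 1 / 2)\<^sup>2 + 3 / 4)" using that by (intro mult_nonneg_nonneg add_nonneg_nonneg) auto
  also have "\<dots> = c\<^sup>2 * z ^ 3 - (c * z\<^sup>2 - z)"
    by (simp add: power2_eq_square power3_eq_cube algebra_simps)
  finally show ?thesis by simp
qed

text \<open>The sum of the coefficients of all cubic and quartic remainders in one step. Its size is irrelevant,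
since it is multiplied by a quantity that vanishes as the mesh of the grid tends to zero for fixed \<open>e\<close>.\<close>

definition remainder_const :: "real \<Rightarrow> real \<Rightarrow> real" where
  "remainder_const C e = 8 / e ^ 3 + 2 * C / e\<^sup>2 + (1 / e ^ 3 + 2 * C / e\<^sup>2) + (1 / (4 * e ^ 4) + C / (2 * e ^ 3))
     + (1 / (2 * e\<^sup>2) + 2 * C / e)\<^sup>2"

text \<open>Up to cubic and quartic remainders, one step changes the function by a quadratic polynomial in the
increments \<open>p\<close> and \<open>q\<close>, although the step itself involves positive parts. The reason is
\<open>(max 0 (u - p))\<^sup>2 = (u - p)\<^sup>2 - (max 0 (p - u))\<^sup>2\<close>: on the squared radius the reflection acts only
through the square of the push, which \<open>quadratic_minus_linear_le\<close> controls.\<close>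

lemma lyapunov_step:
  fixes u v p q C e :: real
  assumes e: "0 < e" and C: "0 \<le> C" and uv: "0 \<le> u" "0 \<le> v"
  defines "r \<equiv> radius e u v" and "h \<equiv> \<bar>p\<bar> + \<bar>q\<bar>"
    and "L \<equiv> p\<^sup>2 + q\<^sup>2 - 2 * (u * p + v * q)"
  shows "lyapunov C e (max 0 (u - p)) (max 0 (v - q)) \<le> lyapunov C e u v
     + L - (1 / (2 * r\<^sup>2) + 2 * C / r) * L
     + (1 / (4 * r ^ 4) + C / (2 * r ^ 3)) * (2 * (u * p + v * q))\<^sup>2 + p + q
     + remainder_const C e * (h ^ 3 + h ^ 4)"
proof -
  define u' v' where "u' = max 0 (u - p)" and "v' = max 0 (v - q)"
  define z w where "z = max 0 (p - u)" and "w = max 0 (q - v)"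
  define r' where "r' = radius e u' v'"
  define D where "D = r'\<^sup>2 - r\<^sup>2"
  define b where "b = p\<^sup>2 + q\<^sup>2 - z\<^sup>2 - w\<^sup>2"
  define a where "a = 2 * (u * p + v * q)"
  define k where "k = 1 / (2 * r\<^sup>2) + 2 * C / r"
  define k2 where "k2 = 1 / (4 * r ^ 4) + C / (2 * r ^ 3)"
  define ke where "ke = 1 / (2 * e\<^sup>2) + 2 * C / e"
  have uv': "0 \<le> u'" "0 \<le> v'" by (auto simp: u'_def v'_def)
  have h0: "0 \<le> h" by (simp add: h_def)
  have r: "e \<le> r" "u \<le> r" "v \<le> r" "0 < r" "e \<le> r'" "0 < r'"
    using radius_bounds[OF e uv] radius_bounds[OF e uv'] by (auto simp: r_def r'_def)
  have r2: "r\<^sup>2 = u\<^sup>2 + v\<^sup>2 + e\<^sup>2" "r'\<^sup>2 = u'\<^sup>2 + v'\<^sup>2 + e\<^sup>2"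
    by (simp_all add: r_def r'_def radius_def)
  have u2: "u'\<^sup>2 = (u - p)\<^sup>2 - z\<^sup>2" "u' = u - p + z"
    by (auto simp: u'_def z_def max_def power2_commute)
  have v2: "v'\<^sup>2 = (v - q)\<^sup>2 - w\<^sup>2" "v' = v - q + w"
    by (auto simp: v'_def w_def max_def power2_commute)
  have D_eq: "D = b - a"
    unfolding D_def r2 u2(1) v2(1) a_def b_def by (simp add: power2_eq_square algebra_simps)
  have DL: "D = L - (z\<^sup>2 + w\<^sup>2)"
    unfolding D_def r2 u2(1) v2(1) L_def by (simp add: power2_eq_square algebra_simps)
  have zw: "0 \<le> z" "0 \<le> w" "z \<le> \<bar>p\<bar>" "w \<le> \<bar>q\<bar>" using uv by (auto simp: z_def w_def)
  have "\<bar>r' - r\<bar> \<le> \<bar>u' - u\<bar> + \<bar>v' - v\<bar>"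
    unfolding r_def r'_def radius_def by (rule sqrt_sum_squares_lipschitz)
  also have "\<dots> \<le> h" using uv by (auto simp: u'_def v'_def h_def)
  finally have lip: "\<bar>r' - r\<bar> \<le> h" .
  note lnr = ln_increment[OF e r(1,5) lip, folded D_def]
  note sqr = radius_increment[OF e r(1,5) lip, folded D_def]
  have z2: "z\<^sup>2 \<le> p\<^sup>2" "w\<^sup>2 \<le> q\<^sup>2" using zw by (auto simp: abs_le_square_iff[symmetric])
  have b: "0 \<le> b" "b \<le> h\<^sup>2"
  proof -
    have "0 \<le> z\<^sup>2" "0 \<le> w\<^sup>2" "0 \<le> 2 * \<bar>p\<bar> * \<bar>q\<bar>" by simp_all
    moreover have "h\<^sup>2 = p\<^sup>2 + q\<^sup>2 + 2 * \<bar>p\<bar> * \<bar>q\<bar>" by (simp add: h_def power2_sum)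
    ultimately show "0 \<le> b" "b \<le> h\<^sup>2" using z2 unfolding b_def by linarith+
  qed
  have "\<bar>u * p + v * q\<bar> \<le> u * \<bar>p\<bar> + v * \<bar>q\<bar>" 
    using uv abs_triangle_ineq[of "u * p" "v * q"] by (simp add: abs_mult)
  also have "\<dots> \<le> r * \<bar>p\<bar> + r * \<bar>q\<bar>" using r by (intro add_mono mult_right_mono) auto
  finally have a: "\<bar>a\<bar> \<le> 2 * r * h" by (simp add: a_def h_def algebra_simps)
  \<comment> \<open>Only the linear part \<open>a\<close> of the increment \<open>D = b - a\<close> contributes to \<open>D\<^sup>2\<close> at second order.\<close>
  have "D\<^sup>2 \<le> a\<^sup>2 + 2 * (\<bar>a\<bar> * b) + b\<^sup>2"
  proof -
    have "- (a * b) \<le> \<bar>a\<bar> * b" using b by (metis abs_ge_minus_self abs_mult abs_of_nonneg)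
    then show ?thesis unfolding D_eq by (simp add: power2_eq_square algebra_simps)
  qed
  also have "\<bar>a\<bar> * b \<le> (2 * r * h) * h\<^sup>2" using a b h0 r by (intro mult_mono) auto
  also have "b\<^sup>2 \<le> (h\<^sup>2)\<^sup>2" using b by (intro power_mono) auto
  finally have D2: "D\<^sup>2 \<le> a\<^sup>2 + 4 * r * h ^ 3 + h ^ 4"
    by (simp add: power2_eq_square power3_eq_cube power4_eq_xxxx)
  have k2: "0 \<le> k2" using C r by (simp add: k2_def)
  have k0: "0 \<le> k" "k \<le> ke"
    unfolding k_def ke_def using C r e
    by (auto intro!: add_mono divide_left_mono mult_left_mono power_mono)
  have "k2 * D\<^sup>2 \<le> k2 * (a\<^sup>2 + 4 * r * h ^ 3 + h ^ 4)" using D2 k2 by (intro mult_left_mono)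
  also have "\<dots> = k2 * a\<^sup>2 + (1 / r ^ 3 + 2 * C / r\<^sup>2) * h ^ 3 + k2 * h ^ 4"
    using r by (simp add: k2_def field_simps power2_eq_square power3_eq_cube power4_eq_xxxx)
  also have "(1 / r ^ 3 + 2 * C / r\<^sup>2) * h ^ 3 \<le> (1 / e ^ 3 + 2 * C / e\<^sup>2) * h ^ 3"
    using r e C h0 by (intro mult_right_mono add_mono divide_left_mono power_mono) auto
  also have "k2 * h ^ 4 \<le> (1 / (4 * e ^ 4) + C / (2 * e ^ 3)) * h ^ 4"
    unfolding k2_def
    using r e C h0 by (intro mult_right_mono add_mono divide_left_mono power_mono mult_left_mono) auto
  finally have quad: "k2 * D\<^sup>2 \<le> k2 * a\<^sup>2 + (1 / e ^ 3 + 2 * C / e\<^sup>2) * h ^ 3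
      + (1 / (4 * e ^ 4) + C / (2 * e ^ 3)) * h ^ 4" by simp
  have push: "k * (z\<^sup>2 + w\<^sup>2) - (z + w) \<le> ke\<^sup>2 * h ^ 3"
  proof -
    have "k * (z\<^sup>2 + w\<^sup>2) \<le> ke * (z\<^sup>2 + w\<^sup>2)" using k0 by (intro mult_right_mono) auto
    moreover have "ke * z\<^sup>2 - z \<le> ke\<^sup>2 * z ^ 3" "ke * w\<^sup>2 - w \<le> ke\<^sup>2 * w ^ 3"
      using quadratic_minus_linear_le zw k0 by auto
    moreover have "ke\<^sup>2 * (z ^ 3 + w ^ 3) \<le> ke\<^sup>2 * h ^ 3"
    proof (rule mult_left_mono)
      have "z ^ 3 + w ^ 3 \<le> \<bar>p\<bar> ^ 3 + \<bar>q\<bar> ^ 3" using zw by (intro add_mono power_mono) auto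
      also have "\<dots> \<le> h ^ 3"
      proof -
        have "0 \<le> 3 * (\<bar>p\<bar> * \<bar>q\<bar> * h)" by (simp add: h_def)
        also have "\<dots> = h ^ 3 - (\<bar>p\<bar> ^ 3 + \<bar>q\<bar> ^ 3)"
          unfolding h_def by algebra
        finally show ?thesis by simp
      qed
      finally show "z ^ 3 + w ^ 3 \<le> h ^ 3" .
    qed simp
    ultimately show ?thesis by (simp add: algebra_simps)
  qed
  have split: "k * D = D / (2 * r\<^sup>2) + 4 * C * (D / (2 * r))"
    "k2 * D\<^sup>2 = D\<^sup>2 / (4 * r ^ 4) + 4 * C * (D\<^sup>2 / (8 * r ^ 3))"
    by (simp_all add: k_def k2_def algebra_simps)
  have "4 * C * (r + D / (2 * r) - D\<^sup>2 / (8 * r ^ 3) - h ^ 3 / (2 * e\<^sup>2)) \<le> 4 * C * r'"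
    using sqr C by (intro mult_left_mono) auto
  with lnr have "ln r + 4 * C * r + k * D - k2 * D\<^sup>2 - (8 / e ^ 3 + 2 * C / e\<^sup>2) * h ^ 3 \<le> ln r' + 4 * C * r'"
    unfolding split by (simp add: algebra_simps power_divide)
  then have "- ln r' - 4 * C * r' \<le> - ln r - 4 * C * r - k * L + k * (z\<^sup>2 + w\<^sup>2) + k2 * D\<^sup>2
      + (8 / e ^ 3 + 2 * C / e\<^sup>2) * h ^ 3"
    unfolding DL by (simp add: algebra_simps)
  moreover have "u'\<^sup>2 + v'\<^sup>2 \<le> u\<^sup>2 + v\<^sup>2 + L"
    unfolding u2(1) v2(1) L_def by (simp add: power2_eq_square algebra_simps)
  moreover have "- (u' + v') = - (u + v) + p + q - (z + w)" using u2(2) v2(2) by simp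
  ultimately have main: "lyapunov C e u' v' \<le> lyapunov C e u v + L - k * L + k2 * a\<^sup>2 + p + q
      + ((8 / e ^ 3 + 2 * C / e\<^sup>2) * h ^ 3 + (1 / e ^ 3 + 2 * C / e\<^sup>2) * h ^ 3
      + (1 / (4 * e ^ 4) + C / (2 * e ^ 3)) * h ^ 4 + ke\<^sup>2 * h ^ 3)"
    using quad push unfolding lyapunov_def r_def[symmetric] r'_def[symmetric] by linarith
  define c1 c2 where "c1 = (8 / e ^ 3 + 2 * C / e\<^sup>2) + (1 / e ^ 3 + 2 * C / e\<^sup>2) + ke\<^sup>2"
    and "c2 = 1 / (4 * e ^ 4) + C / (2 * e ^ 3)"
  have "(8 / e ^ 3 + 2 * C / e\<^sup>2) * h ^ 3 + (1 / e ^ 3 + 2 * C / e\<^sup>2) * h ^ 3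
      + (1 / (4 * e ^ 4) + C / (2 * e ^ 3)) * h ^ 4 + ke\<^sup>2 * h ^ 3 = c1 * h ^ 3 + c2 * h ^ 4"
    by (simp add: c1_def c2_def distrib_right)
  also have "\<dots> \<le> (c1 + c2) * (h ^ 3 + h ^ 4)"
  proof -
    have "0 \<le> c1" "0 \<le> c2" using e C by (auto simp: c1_def c2_def)
    then show ?thesis using h0 by (simp add: algebra_simps)
  qed
  also have "\<dots> = remainder_const C e * (h ^ 3 + h ^ 4)"
    by (simp add: remainder_const_def c1_def c2_def ke_def)
  finally have "lyapunov C e u' v' \<le> lyapunov C e u v + L - k * L + k2 * a\<^sup>2 + p + q
      + remainder_const C e * (h ^ 3 + h ^ 4)"
    by (rule order_trans[OF main add_left_mono])
  then show ?thesis
    unfolding u'_def v'_def k_def k2_def a_def .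
qed

section \<open>Gaussian averages of one step\<close>

definition gaussian :: "real \<Rightarrow> real measure" where
  "gaussian \<sigma> = density lborel (\<lambda>z. ennreal (normal_density 0 \<sigma> z))"

lemma sets_gaussian [simp, measurable_cong]: "sets (gaussian \<sigma>) = sets borel"
  by (simp add: gaussian_def)

lemma space_gaussian [simp]: "space (gaussian \<sigma>) = UNIV"
  by (simp add: gaussian_def)

lemma prob_space_gaussian: "0 < \<sigma> \<Longrightarrow> prob_space (gaussian \<sigma>)"
  unfolding gaussian_def by (rule prob_space_normal_density)

lemma gaussian_integrals:
  assumes "0 < \<sigma>"
  shows "has_bochner_integral (gaussian \<sigma>) (\<lambda>_. 1 :: real) 1"
    and "has_bochner_integral (gaussian \<sigma>) (\<lambda>x. x) 0"
    and "has_bochner_integral (gaussian \<sigma>) (\<lambda>x. x\<^sup>2) (\<sigma>\<^sup>2)"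
    and "has_bochner_integral (gaussian \<sigma>) (\<lambda>x. \<bar>x\<bar> ^ 3) (2 * sqrt (2 / pi) * \<sigma> ^ 3)"
    and "has_bochner_integral (gaussian \<sigma>) (\<lambda>x. x ^ 4) (3 * \<sigma> ^ 4)"
proof -
  have *: "has_bochner_integral (gaussian \<sigma>) f c"
    if "has_bochner_integral lborel (\<lambda>x. normal_density 0 \<sigma> x * f x) c" "f \<in> borel_measurable borel" for f c
    unfolding gaussian_def using that
    by (intro has_bochner_integral_density) (auto simp: normal_density_nonneg)
  show "has_bochner_integral (gaussian \<sigma>) (\<lambda>_. 1 :: real) 1"
    by (rule *) (use normal_moment_even[OF assms, of 0 0] in simp_all)
  show "has_bochner_integral (gaussian \<sigma>) (\<lambda>x. x) 0"
    by (rule *) (use normal_moment_odd[OF assms, of 0 0] in simp_all)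
  show "has_bochner_integral (gaussian \<sigma>) (\<lambda>x. x\<^sup>2) (\<sigma>\<^sup>2)"
    by (rule *) (use normal_moment_even[OF assms, of 0 1] in simp_all)
  show "has_bochner_integral (gaussian \<sigma>) (\<lambda>x. \<bar>x\<bar> ^ 3) (2 * sqrt (2 / pi) * \<sigma> ^ 3)"
  proof (rule *)
    show "has_bochner_integral lborel (\<lambda>x. normal_density 0 \<sigma> x * \<bar>x\<bar> ^ 3) (2 * sqrt (2 / pi) * \<sigma> ^ 3)"
      using normal_moment_abs_odd[OF assms, of 0 1] by (simp add: mult_ac)
  qed simp
  show "has_bochner_integral (gaussian \<sigma>) (\<lambda>x. x ^ 4) (3 * \<sigma> ^ 4)"
  proof (rule *)
    have "(fact (2 * 2) :: real) / ((2 / \<sigma>\<^sup>2)\<^sup>2 * fact 2) = 3 * \<sigma> ^ 4"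
      using assms by (simp add: fact_numeral power2_eq_square power4_eq_xxxx)
    then show "has_bochner_integral lborel (\<lambda>x. normal_density 0 \<sigma> x * x ^ 4) (3 * \<sigma> ^ 4)"
      using normal_moment_even[OF assms, of 0 2] by simp
  qed simp
qed

definition abs_moment3 :: real where "abs_moment3 = 2 * sqrt (2 / pi)"

text \<open>The second claim makes it possible to integrate twice: the value for one variable is again a
nonnegative polynomial of this form in the other variable.\<close>

lemma nn_integral_gaussian_quartic:
  assumes "0 < \<sigma>" and nonneg: "\<And>x. 0 \<le> a + b * x + c * x\<^sup>2 + d * (\<bar>x\<bar> ^ 3 + x ^ 4)"
  shows "(\<integral>\<^sup>+x. ennreal (a + b * x + c * x\<^sup>2 + d * (\<bar>x\<bar> ^ 3 + x ^ 4)) \<partial>gaussian \<sigma>)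
     = ennreal (a + c * \<sigma>\<^sup>2 + d * (abs_moment3 * \<sigma> ^ 3 + 3 * \<sigma> ^ 4))"
    and "0 \<le> a + c * \<sigma>\<^sup>2 + d * (abs_moment3 * \<sigma> ^ 3 + 3 * \<sigma> ^ 4)"
proof -
  note I = gaussian_integrals[OF assms(1)]
  have "has_bochner_integral (gaussian \<sigma>) (\<lambda>x. a * 1 + b * x + c * x\<^sup>2 + d * (\<bar>x\<bar> ^ 3 + x ^ 4))
     (a * 1 + b * 0 + c * \<sigma>\<^sup>2 + d * (2 * sqrt (2 / pi) * \<sigma> ^ 3 + 3 * \<sigma> ^ 4))"
    by (intro has_bochner_integral_add has_bochner_integral_mult_right I)
  then have *: "has_bochner_integral (gaussian \<sigma>) (\<lambda>x. a + b * x + c * x\<^sup>2 + d * (\<bar>x\<bar> ^ 3 + x ^ 4))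
     (a + c * \<sigma>\<^sup>2 + d * (abs_moment3 * \<sigma> ^ 3 + 3 * \<sigma> ^ 4))"
    by (simp add: abs_moment3_def)
  then show "(\<integral>\<^sup>+x. ennreal (a + b * x + c * x\<^sup>2 + d * (\<bar>x\<bar> ^ 3 + x ^ 4)) \<partial>gaussian \<sigma>)
     = ennreal (a + c * \<sigma>\<^sup>2 + d * (abs_moment3 * \<sigma> ^ 3 + 3 * \<sigma> ^ 4))"
    by (subst nn_integral_eq_integral) (auto simp: nonneg has_bochner_integral_iff)
  show "0 \<le> a + c * \<sigma>\<^sup>2 + d * (abs_moment3 * \<sigma> ^ 3 + 3 * \<sigma> ^ 4)"
    unfolding has_bochner_integral_integral_eq[OF *, symmetric]
    by (rule Bochner_Integration.integral_nonneg) (rule nonneg)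
qed

definition drift_const :: "real \<Rightarrow> real" where
  "drift_const C = 2 + 8 * C\<^sup>2 + 2 * C"

text \<open>The discrete version of the generator computation. The constant \<open>drift_const C\<close> must not depend on \<open>e\<close>,
because the sum of these terms over all steps stays of order one and is compared with
\<open>ln (1 / (2 e))\<close>. Up to terms that are of order \<open>\<sigma>\<^sup>2\<close> uniformly in \<open>e\<close> or of order \<open>\<sigma> ^ 3\<close>,
the drift of the logarithm costs at most \<open>2 C \<sigma>\<^sup>2 / r\<close>, and the factor \<open>4 C\<close> in front of the radius
is chosen so that the radius term contributes at most \<open>- 2 C \<sigma>\<^sup>2 / r\<close>.\<close>

lemma expected_second_order_part:
  fixes u v C e \<sigma> :: real
  assumes e: "0 < e" and C: "0 \<le> C" and uv: "0 \<le> u" "0 \<le> v" and \<sigma>: "0 < \<sigma>" "\<sigma> \<le> 1"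
  defines "r \<equiv> radius e u v" and "m \<equiv> C * \<sigma>\<^sup>2"
  defines "k \<equiv> 1 / (2 * r\<^sup>2) + 2 * C / r" and "k2 \<equiv> 1 / (4 * r ^ 4) + C / (2 * r ^ 3)"
  shows "(1 - k) * (2 * (\<sigma>\<^sup>2 + m\<^sup>2) - 2 * (u + v) * m) + k2 * (4 * ((u\<^sup>2 + v\<^sup>2) * (\<sigma>\<^sup>2 + m\<^sup>2) + 2 * u * v * m\<^sup>2)) + 2 * m
     \<le> drift_const C * \<sigma>\<^sup>2 + (2 + 1 / e\<^sup>2 + 2 * C / e) * C\<^sup>2 * \<sigma> ^ 3"
proof -
  define M where "M = \<sigma>\<^sup>2 + m\<^sup>2"
  note rb = radius_bounds[OF e uv, folded r_def]
  have r2: "r\<^sup>2 = u\<^sup>2 + v\<^sup>2 + e\<^sup>2" by (simp add: r_def radius_def)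
  have m: "0 \<le> m" "0 \<le> m\<^sup>2" "0 \<le> M" "\<sigma>\<^sup>2 \<le> M" using C by (simp_all add: m_def M_def)
  have k: "0 \<le> k" "0 \<le> k2" using rb C by (auto simp: k_def k2_def)
  have k2r: "4 * k2 * r\<^sup>2 = 1 / r\<^sup>2 + 2 * C / r"
    using rb by (simp add: k2_def field_simps power2_eq_square power3_eq_cube power4_eq_xxxx)
  have a1: "k * (2 * (u + v) * m) \<le> k * (4 * r * m)"
    using rb k m by (intro mult_left_mono mult_right_mono) auto
  have a2: "k * (4 * r * m) = 2 * m / r + 8 * C * m"
    using rb by (simp add: k_def field_simps power2_eq_square)
  have b1: "4 * k2 * ((u\<^sup>2 + v\<^sup>2) * M) \<le> 4 * k2 * (r\<^sup>2 * M)"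
    using k m unfolding r2 by (intro mult_left_mono mult_right_mono) auto
  have "0 \<le> (u - v)\<^sup>2" by simp
  then have "2 * u * v \<le> r\<^sup>2" unfolding r2 power2_diff using zero_le_power2[of e] by linarith
  then have b2: "4 * k2 * (2 * u * v * m\<^sup>2) \<le> 4 * k2 * (r\<^sup>2 * m\<^sup>2)"
    using k by (intro mult_left_mono mult_right_mono) auto
  have b3: "4 * k2 * (r\<^sup>2 * m\<^sup>2) \<le> (1 / e\<^sup>2 + 2 * C / e) * m\<^sup>2"
  proof -
    have "1 / r\<^sup>2 + 2 * C / r \<le> 1 / e\<^sup>2 + 2 * C / e"
      using rb e C by (intro add_mono divide_left_mono power_mono) auto
    then have "(4 * k2 * r\<^sup>2) * m\<^sup>2 \<le> (1 / e\<^sup>2 + 2 * C / e) * m\<^sup>2"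
      unfolding k2r by (intro mult_right_mono) auto
    then show ?thesis by (simp add: mult_ac)
  qed
  have c: "4 * k2 * (r\<^sup>2 * M) - 2 * k * M = - (2 * C / r) * M"
  proof -
    have "4 * k2 * (r\<^sup>2 * M) = (1 / r\<^sup>2 + 2 * C / r) * M" using k2r by (simp add: mult_ac)
    then show ?thesis by (simp add: k_def algebra_simps)
  qed
  have d: "- (2 * C / r) * M \<le> - (2 * m / r)"
  proof -
    have "(2 * C / r) * \<sigma>\<^sup>2 \<le> (2 * C / r) * M" using m rb C by (intro mult_left_mono) auto
    then show ?thesis by (simp add: m_def)
  qed
  have uvm: "0 \<le> 2 * (u + v) * m" using uv m by simp
  have msq: "m\<^sup>2 \<le> C\<^sup>2 * \<sigma> ^ 3"
  proof -
    have "\<sigma> ^ 4 \<le> \<sigma> ^ 3" using \<sigma> by (intro power_decreasing) auto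
    then have "C\<^sup>2 * \<sigma> ^ 4 \<le> C\<^sup>2 * \<sigma> ^ 3" by (intro mult_left_mono) auto
    then show ?thesis by (simp add: m_def power_mult_distrib power2_eq_square power4_eq_xxxx mult_ac)
  qed
  have "(1 - k) * (2 * M - 2 * (u + v) * m) + k2 * (4 * ((u\<^sup>2 + v\<^sup>2) * M + 2 * u * v * m\<^sup>2)) + 2 * m
    = 2 * M - 2 * (u + v) * m - 2 * k * M + k * (2 * (u + v) * m) + 4 * k2 * ((u\<^sup>2 + v\<^sup>2) * M)
      + 4 * k2 * (2 * u * v * m\<^sup>2) + 2 * m"
    by (simp add: algebra_simps)
  also have "\<dots> \<le> 2 * M + 8 * C * m + (1 / e\<^sup>2 + 2 * C / e) * m\<^sup>2 + 2 * m"
    using a1 a2 b1 b2 b3 c d uvm by linarith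
  also have "\<dots> = (2 + 8 * C\<^sup>2 + 2 * C) * \<sigma>\<^sup>2 + (2 + 1 / e\<^sup>2 + 2 * C / e) * m\<^sup>2"
    by (simp add: M_def m_def power2_eq_square algebra_simps)
  also have "\<dots> \<le> (2 + 8 * C\<^sup>2 + 2 * C) * \<sigma>\<^sup>2 + (2 + 1 / e\<^sup>2 + 2 * C / e) * (C\<^sup>2 * \<sigma> ^ 3)"
    using msq e C by (intro add_left_mono mult_left_mono) auto
  finally show ?thesis by (simp add: M_def drift_const_def mult.assoc)
qed

lemma power_add_le_convex:
  fixes a b :: real assumes "0 \<le> a" "0 \<le> b"
  shows "(a + b) ^ 3 \<le> 4 * (a ^ 3 + b ^ 3)" "(a + b) ^ 4 \<le> 8 * (a ^ 4 + b ^ 4)"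
proof -
  have "0 \<le> 3 * (a + b) * (a - b)\<^sup>2" using assms by simp
  also have "\<dots> = 4 * (a ^ 3 + b ^ 3) - (a + b) ^ 3"
    by (simp add: power2_eq_square power3_eq_cube algebra_simps)
  finally show "(a + b) ^ 3 \<le> 4 * (a ^ 3 + b ^ 3)" by simp
  have *: "(x + y)\<^sup>2 \<le> 2 * (x\<^sup>2 + y\<^sup>2)" for x y :: real
  proof -
    have "0 \<le> (x - y)\<^sup>2" by simp
    then have "0 \<le> x\<^sup>2 + y\<^sup>2 - 2 * x * y" by (simp only: power2_diff)
    then show ?thesis unfolding power2_sum by argo
  qed
  have "((a + b)\<^sup>2)\<^sup>2 \<le> (2 * (a\<^sup>2 + b\<^sup>2))\<^sup>2" using *[of a b] by (intro power_mono) auto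
  also have "\<dots> = 4 * (a\<^sup>2 + b\<^sup>2)\<^sup>2" by (simp only: power_mult_distrib) simp
  also have "\<dots> \<le> 4 * (2 * ((a\<^sup>2)\<^sup>2 + (b\<^sup>2)\<^sup>2))" using *[of "a\<^sup>2" "b\<^sup>2"] by (intro mult_left_mono) auto
  finally show "(a + b) ^ 4 \<le> 8 * (a ^ 4 + b ^ 4)" by simp
qed

lemma cubic_quartic_bound:
  fixes m \<xi> \<eta> :: real assumes m: "0 \<le> m"
  defines "h \<equiv> \<bar>m + \<xi>\<bar> + \<bar>m - \<eta>\<bar>"
  shows "h ^ 3 + h ^ 4 \<le> 64 * (2 * (m ^ 3 + m ^ 4) + (\<bar>\<xi>\<bar> ^ 3 + \<xi> ^ 4) + (\<bar>\<eta>\<bar> ^ 3 + \<eta> ^ 4))"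
proof -
  have "h \<le> (m + \<bar>\<xi>\<bar>) + (m + \<bar>\<eta>\<bar>)" "0 \<le> h" using m by (auto simp: h_def)
  then have h: "h ^ 3 \<le> ((m + \<bar>\<xi>\<bar>) + (m + \<bar>\<eta>\<bar>)) ^ 3" "h ^ 4 \<le> ((m + \<bar>\<xi>\<bar>) + (m + \<bar>\<eta>\<bar>)) ^ 4"
    by (auto intro: power_mono)
  have a: "(\<bar>\<xi>\<bar>) ^ 4 = \<xi> ^ 4" "(\<bar>\<eta>\<bar>) ^ 4 = \<eta> ^ 4" by (simp_all add: power_even_abs)
  have p: "0 \<le> m ^ 3" "0 \<le> \<bar>\<xi>\<bar> ^ 3" "0 \<le> \<bar>\<eta>\<bar> ^ 3" using m by auto
  note c = power_add_le_convex[of "m + \<bar>\<xi>\<bar>" "m + \<bar>\<eta>\<bar>"] power_add_le_convex[of m "\<bar>\<xi>\<bar>"]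
    power_add_le_convex[of m "\<bar>\<eta>\<bar>"]
  show ?thesis using h c p m unfolding a distrib_left by linarith
qed

definition potential_offset :: "real \<Rightarrow> real" where
  "potential_offset C = (4 * C + 2)\<^sup>2 / 2 + 4 * C + 1"

text \<open>The shift makes the function nonnegative, so that nonnegative integrals and Markov's inequality
apply to it.\<close>

definition potential :: "real \<Rightarrow> real \<Rightarrow> real \<Rightarrow> real \<Rightarrow> real" where
  "potential C e u v = lyapunov C e u v + potential_offset C"

lemma potential_nonneg:
  assumes "0 < e" "e \<le> 1" "0 \<le> C" "0 \<le> u" "0 \<le> v"
  shows "0 \<le> potential C e u v"
proof -
  note r = radius_bounds[OF assms(1,4,5)]
  define a where "a = 4 * C + 2"
  have "0 \<le> (u - a / 2)\<^sup>2" "0 \<le> (v - a / 2)\<^sup>2" by simp_all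
  then have "0 \<le> u\<^sup>2 - a * u + a\<^sup>2 / 4" "0 \<le> v\<^sup>2 - a * v + a\<^sup>2 / 4"
    by (simp_all add: power2_eq_square algebra_simps)
  then have "0 \<le> u\<^sup>2 + v\<^sup>2 - (a * u + a * v) + a\<^sup>2 / 2" by linarith
  moreover have "ln (radius e u v) \<le> radius e u v - 1" using r by (intro ln_le_minus_one)
  moreover have "4 * C * radius e u v \<le> 4 * C * (u + v + 1)"
    using r(5) assms by (intro mult_left_mono) auto
  moreover have "radius e u v \<le> u + v + 1" using r assms by linarith
  moreover have "a * u + a * v = 4 * C * (u + v + 1) - 4 * C + 2 * u + 2 * v"
    by (simp add: a_def algebra_simps)
  ultimately show ?thesis
    unfolding potential_def lyapunov_def potential_offset_def a_def[symmetric] by linarith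
qed

lemma potential_near_corner:
  assumes "0 < e" "e \<le> 1" "0 \<le> C" "0 \<le> u" "0 \<le> v" "u \<le> e" "v \<le> e"
  shows "ln (1 / (2 * e)) \<le> potential C e u v"
proof -
  note r = radius_bounds[OF assms(1,4,5)]
  have uv2: "u\<^sup>2 \<le> e\<^sup>2" "v\<^sup>2 \<le> e\<^sup>2" using assms by (auto intro: power_mono)
  have "u\<^sup>2 + v\<^sup>2 + e\<^sup>2 \<le> 4 * e\<^sup>2" using uv2 zero_le_power2[of e] by linarith
  then have r2: "radius e u v \<le> 2 * e"
    unfolding radius_def using assms by (intro real_le_lsqrt) (simp_all add: power_mult_distrib)
  then have "ln (radius e u v) \<le> ln (2 * e)" using r by simp
  moreover have "4 * C * radius e u v \<le> 4 * C * 2"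
    using r2 assms by (intro mult_left_mono) auto
  moreover have "0 \<le> u\<^sup>2" "0 \<le> v\<^sup>2" "0 \<le> C\<^sup>2" by simp_all
  moreover have "potential_offset C = 8 * C\<^sup>2 + 12 * C + 3"
    by (simp add: potential_offset_def power2_eq_square algebra_simps)
  moreover have "ln (1 / (2 * e)) = - ln (2 * e)" using assms by (simp add: ln_div)
  ultimately show ?thesis
    using assms unfolding potential_def lyapunov_def by linarith
qed

text \<open>Away from the corner the bound is independent of \<open>e\<close>; this is where it matters that the two
processes do not start at the corner.\<close>

lemma potential_le_start:
  assumes "0 < e" "0 \<le> C" "0 \<le> u" "0 \<le> v" "0 < u + v"
  shows "potential C e u v \<le> u\<^sup>2 + v\<^sup>2 - ln (sqrt (u\<^sup>2 + v\<^sup>2)) + potential_offset C"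
proof -
  note r = radius_bounds[OF assms(1,3,4)]
  have "0 < u\<^sup>2 + v\<^sup>2" using assms by (auto simp: sum_power2_gt_zero_iff)
  then have "ln (sqrt (u\<^sup>2 + v\<^sup>2)) \<le> ln (radius e u v)"
    unfolding radius_def by (subst ln_le_cancel_iff) (auto intro!: add_pos_nonneg)
  moreover have "0 \<le> 4 * C * radius e u v" using r assms by simp
  ultimately show ?thesis unfolding potential_def lyapunov_def using assms by linarith
qed

definition error_const :: "real \<Rightarrow> real \<Rightarrow> real" where
  "error_const C e = (2 + 1 / e\<^sup>2 + 2 * C / e) * C\<^sup>2
     + 128 * remainder_const C e * (C ^ 3 + C ^ 4 + abs_moment3 + 3)"

text \<open>The pointwise bound of \<open>lyapunov_step\<close> is dominated by a polynomial in \<open>\<xi>\<close>, \<open>\<eta>\<close> and their absolute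
values. Integrating it in each variable and comparing second-order terms gives the claim. The second
Gaussian enters with the opposite sign, as \<open>- B2\<close> plays the role of the second process.\<close>

lemma expected_potential_step:
  fixes u v C e \<sigma> :: real
  assumes e: "0 < e" "e \<le> 1" and C: "0 \<le> C" and uv: "0 \<le> u" "0 \<le> v" and \<sigma>: "0 < \<sigma>" "\<sigma> \<le> 1"
  defines "m \<equiv> C * \<sigma>\<^sup>2"
  shows "(\<integral>\<^sup>+\<xi>. \<integral>\<^sup>+\<eta>. ennreal (potential C e (max 0 (u - (m + \<xi>))) (max 0 (v - (m - \<eta>)))) \<partial>gaussian \<sigma> \<partial>gaussian \<sigma>)
     \<le> ennreal (potential C e u v + drift_const C * \<sigma>\<^sup>2 + error_const C e * \<sigma> ^ 3)"
proof -
  define r where "r = radius e u v"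
  define k where "k = 1 / (2 * r\<^sup>2) + 2 * C / r"
  define k2 where "k2 = 1 / (4 * r ^ 4) + C / (2 * r ^ 3)"
  define R where "R = remainder_const C e"
  define P where "P = potential C e u v"
  define J where "J = abs_moment3 * \<sigma> ^ 3 + 3 * \<sigma> ^ 4"
  define g where "g x = \<bar>x\<bar> ^ 3 + x ^ 4" for x :: real
  have R: "0 \<le> R" using e C by (auto simp: R_def remainder_const_def)
  have m: "0 \<le> m" using C by (simp add: m_def)
  \<comment> \<open>coefficients in \<open>\<eta>\<close> for fixed \<open>\<xi>\<close>\<close>
  define a where "a \<xi> = P + (1 - k) * ((m + \<xi>)\<^sup>2 + m\<^sup>2 - 2 * (u * (m + \<xi>) + v * m))
      + 4 * k2 * (u * (m + \<xi>) + v * m)\<^sup>2 + (m + \<xi>) + m + 64 * R * (2 * (m ^ 3 + m ^ 4) + g \<xi>)" for \<xi>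
  define b where "b \<xi> = (1 - k) * (2 * v - 2 * m) - 8 * k2 * (u * (m + \<xi>) + v * m) * v - 1" for \<xi>
  define c where "c = (1 - k) + 4 * k2 * v\<^sup>2"
  define a' where "a' = P + (1 - k) * (2 * m\<^sup>2 - 2 * (u + v) * m) + 4 * k2 * ((u + v) * m)\<^sup>2 + 2 * m
      + 64 * R * (2 * (m ^ 3 + m ^ 4)) + c * \<sigma>\<^sup>2 + 64 * R * J"
  define b' where "b' = (1 - k) * (2 * m - 2 * u) + 8 * k2 * ((u + v) * m) * u + 1"
  define c' where "c' = (1 - k) + 4 * k2 * u\<^sup>2"
  let ?F = "\<lambda>\<xi> \<eta>. potential C e (max 0 (u - (m + \<xi>))) (max 0 (v - (m - \<eta>)))"
  have F0: "0 \<le> ?F \<xi> \<eta>" for \<xi> \<eta> by (rule potential_nonneg) (use e C in auto)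
  have step: "?F \<xi> \<eta> \<le> a \<xi> + b \<xi> * \<eta> + c * \<eta>\<^sup>2 + 64 * R * (\<bar>\<eta>\<bar> ^ 3 + \<eta> ^ 4)" for \<xi> \<eta>
  proof -
    define p q where "p = m + \<xi>" and "q = m - \<eta>"
    have "?F \<xi> \<eta> \<le> P + (p\<^sup>2 + q\<^sup>2 - 2 * (u * p + v * q)) - k * (p\<^sup>2 + q\<^sup>2 - 2 * (u * p + v * q))
       + k2 * (2 * (u * p + v * q))\<^sup>2 + p + q + R * ((\<bar>p\<bar> + \<bar>q\<bar>) ^ 3 + (\<bar>p\<bar> + \<bar>q\<bar>) ^ 4)"
      using lyapunov_step[OF e(1) C uv, of p q]
      unfolding potential_def P_def R_def p_def[symmetric] q_def[symmetric] k_def k2_def r_def by simp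
    also have "R * ((\<bar>p\<bar> + \<bar>q\<bar>) ^ 3 + (\<bar>p\<bar> + \<bar>q\<bar>) ^ 4)
        \<le> R * (64 * (2 * (m ^ 3 + m ^ 4) + (\<bar>\<xi>\<bar> ^ 3 + \<xi> ^ 4) + (\<bar>\<eta>\<bar> ^ 3 + \<eta> ^ 4)))"
      unfolding p_def q_def by (rule mult_left_mono[OF cubic_quartic_bound[OF m] R])
    also have "P + (p\<^sup>2 + q\<^sup>2 - 2 * (u * p + v * q)) - k * (p\<^sup>2 + q\<^sup>2 - 2 * (u * p + v * q))
       + k2 * (2 * (u * p + v * q))\<^sup>2 + p + q
       + R * (64 * (2 * (m ^ 3 + m ^ 4) + (\<bar>\<xi>\<bar> ^ 3 + \<xi> ^ 4) + (\<bar>\<eta>\<bar> ^ 3 + \<eta> ^ 4)))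
      = a \<xi> + b \<xi> * \<eta> + c * \<eta>\<^sup>2 + 64 * R * (\<bar>\<eta>\<bar> ^ 3 + \<eta> ^ 4)"
      unfolding a_def b_def c_def p_def[symmetric] q_def g_def by algebra
    finally show ?thesis by simp
  qed
  have nn: "0 \<le> a \<xi> + b \<xi> * \<eta> + c * \<eta>\<^sup>2 + 64 * R * (\<bar>\<eta>\<bar> ^ 3 + \<eta> ^ 4)" for \<xi> \<eta>
    using F0 step by (rule order_trans)
  note int1 = nn_integral_gaussian_quartic[OF \<sigma>(1) nn, folded J_def]
  have a_eq: "a \<xi> + c * \<sigma>\<^sup>2 + 64 * R * J = a' + b' * \<xi> + c' * \<xi>\<^sup>2 + 64 * R * (\<bar>\<xi>\<bar> ^ 3 + \<xi> ^ 4)" for \<xi>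
    unfolding a_def a'_def b'_def c'_def g_def by algebra
  note int2 = nn_integral_gaussian_quartic[OF \<sigma>(1) int1(2)[unfolded a_eq], folded J_def]
  have "(\<integral>\<^sup>+\<xi>. \<integral>\<^sup>+\<eta>. ennreal (?F \<xi> \<eta>) \<partial>gaussian \<sigma> \<partial>gaussian \<sigma>)
     \<le> (\<integral>\<^sup>+\<xi>. \<integral>\<^sup>+\<eta>. ennreal (a \<xi> + b \<xi> * \<eta> + c * \<eta>\<^sup>2 + 64 * R * (\<bar>\<eta>\<bar> ^ 3 + \<eta> ^ 4)) \<partial>gaussian \<sigma> \<partial>gaussian \<sigma>)"
    by (intro nn_integral_mono ennreal_leI step)
  also have "\<dots> = ennreal (a' + c' * \<sigma>\<^sup>2 + 64 * R * J)"
    unfolding int1(1) a_eq int2(1) ..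
  also have "\<dots> \<le> ennreal (P + drift_const C * \<sigma>\<^sup>2 + error_const C e * \<sigma> ^ 3)"
  proof (rule ennreal_leI)
    have "a' + c' * \<sigma>\<^sup>2 + 64 * R * J
      = P + ((1 - k) * (2 * (\<sigma>\<^sup>2 + m\<^sup>2) - 2 * (u + v) * m)
          + k2 * (4 * ((u\<^sup>2 + v\<^sup>2) * (\<sigma>\<^sup>2 + m\<^sup>2) + 2 * u * v * m\<^sup>2)) + 2 * m)
        + 128 * R * (m ^ 3 + m ^ 4 + J)"
      unfolding a'_def c'_def c_def by algebra
    also have "\<dots> \<le> P + (drift_const C * \<sigma>\<^sup>2 + (2 + 1 / e\<^sup>2 + 2 * C / e) * C\<^sup>2 * \<sigma> ^ 3)
        + 128 * R * (m ^ 3 + m ^ 4 + J)"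
      using expected_second_order_part[OF e(1) C uv \<sigma>] unfolding k_def k2_def r_def m_def
      by (intro add_left_mono add_right_mono)
    also have "128 * R * (m ^ 3 + m ^ 4 + J) \<le> 128 * R * ((C ^ 3 + C ^ 4 + abs_moment3 + 3) * \<sigma> ^ 3)"
    proof (rule mult_left_mono)
      have pw: "\<sigma> ^ j \<le> \<sigma> ^ 3" if "3 \<le> j" for j using \<sigma> that by (intro power_decreasing) auto
      have "m ^ 3 \<le> C ^ 3 * \<sigma> ^ 3" "m ^ 4 \<le> C ^ 4 * \<sigma> ^ 3"
        unfolding m_def power_mult_distrib power_mult[symmetric]
        using C by (auto intro!: mult_left_mono pw)
      moreover have "\<sigma> ^ 4 \<le> \<sigma> ^ 3" by (rule pw) simp
      ultimately show "m ^ 3 + m ^ 4 + J \<le> (C ^ 3 + C ^ 4 + abs_moment3 + 3) * \<sigma> ^ 3"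
        unfolding J_def by (simp add: distrib_right)
    qed (use R in simp)
    finally show "a' + c' * \<sigma>\<^sup>2 + 64 * R * J \<le> P + drift_const C * \<sigma>\<^sup>2 + error_const C e * \<sigma> ^ 3"
      unfolding error_const_def R_def[symmetric] by (simp add: algebra_simps)
  qed
  finally show ?thesis unfolding P_def .
qed

section \<open>The reflected chain stopped near the corner\<close>

definition near_corner :: "real \<Rightarrow> (real \<times> real) set" where
  "near_corner e = {..e} \<times> {..e}"

text \<open>The distances of two drifted random walks with increments \<open>m + \<xi> k\<close> and \<open>m - \<eta> k\<close> from their running
maxima (started at a prescribed distance \<open>s\<close>), frozen upon the first visit to the square at the
corner. Freezing turns a visit at some time up to \<open>n\<close> into an event about time \<open>n\<close> alone.\<close>

primrec stopped_chain ::
    "real \<Rightarrow> real \<Rightarrow> real \<times> real \<Rightarrow> (nat \<Rightarrow> real) \<Rightarrow> (nat \<Rightarrow> real) \<Rightarrow> nat \<Rightarrow> real \<times> real" where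
  "stopped_chain m e s \<xi> \<eta> 0 = s"
| "stopped_chain m e s \<xi> \<eta> (Suc k) =
     (let (u, v) = stopped_chain m e s \<xi> \<eta> k in
      if (u, v) \<in> near_corner e then (u, v) else (max 0 (u - (m + \<xi> k)), max 0 (v - (m - \<eta> k))))"

lemma stopped_chain_cong:
  assumes "\<And>i. i < k \<Longrightarrow> \<xi> i = \<xi>' i" "\<And>i. i < k \<Longrightarrow> \<eta> i = \<eta>' i"
  shows "stopped_chain m e s \<xi> \<eta> k = stopped_chain m e s \<xi>' \<eta>' k"
  using assms by (induction k) (auto simp: Let_def split: prod.split)

lemma stopped_chain_nonneg:
  assumes "0 \<le> fst s" "0 \<le> snd s"
  shows "0 \<le> fst (stopped_chain m e s \<xi> \<eta> k) \<and> 0 \<le> snd (stopped_chain m e s \<xi> \<eta> k)"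
  using assms by (induction k) (auto simp: Let_def split: prod.splits)

lemma stopped_chain_stays:
  assumes "stopped_chain m e s \<xi> \<eta> k \<in> near_corner e" "k \<le> n"
  shows "stopped_chain m e s \<xi> \<eta> n \<in> near_corner e"
  using assms(2,1) by (induction rule: dec_induct) (auto simp: Let_def split: prod.splits)

lemma near_corner_sets [measurable]: "near_corner e \<in> sets (borel \<Otimes>\<^sub>M borel)"
  unfolding near_corner_def by measurable

lemma measurable_stopped_chain:
  assumes "k \<le> n"
  shows "(\<lambda>(\<xi>, \<eta>). stopped_chain m e s \<xi> \<eta> k)
    \<in> (PiM {..<n} (\<lambda>_. gaussian \<sigma>) \<Otimes>\<^sub>M PiM {..<n} (\<lambda>_. gaussian \<sigma>)) \<rightarrow>\<^sub>M borel \<Otimes>\<^sub>M borel"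
  using assms
proof (induction k)
  case (Suc k)
  let ?P = "PiM {..<n} (\<lambda>_. gaussian \<sigma>) \<Otimes>\<^sub>M PiM {..<n} (\<lambda>_. gaussian \<sigma>)"
  have [measurable]: "(\<lambda>z. stopped_chain m e s (fst z) (snd z) k) \<in> ?P \<rightarrow>\<^sub>M borel \<Otimes>\<^sub>M borel"
    using Suc by (simp add: case_prod_beta')
  have c: "(\<lambda>x. x k) \<in> PiM {..<n} (\<lambda>_. gaussian \<sigma>) \<rightarrow>\<^sub>M borel"
    using measurable_component_singleton[of k "{..<n}" "\<lambda>_. gaussian \<sigma>"] Suc.prems
    by (simp cong: measurable_cong_sets)
  have [measurable]: "(\<lambda>z. fst z k) \<in> borel_measurable ?P" "(\<lambda>z. snd z k) \<in> borel_measurable ?P"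
    by (rule measurable_compose[OF measurable_fst c], rule measurable_compose[OF measurable_snd c])
  show ?case unfolding stopped_chain.simps Let_def case_prod_beta' by measurable
qed (auto simp: case_prod_beta' space_pair_measure intro!: measurable_const)

definition corner_energy :: "real \<Rightarrow> real \<Rightarrow> real \<times> real \<Rightarrow> ennreal" where
  "corner_energy C e s = ennreal (potential C e (fst s) (snd s))"

lemma measurable_corner_energy [measurable]:
  "corner_energy C e \<in> borel_measurable (borel \<Otimes>\<^sub>M borel)"
  unfolding corner_energy_def potential_def lyapunov_def radius_def by measurable

lemma drift_const_nonneg: "0 \<le> C \<Longrightarrow> 0 \<le> drift_const C"
  by (simp add: drift_const_def)

lemma error_const_nonneg: "0 < e \<Longrightarrow> 0 \<le> C \<Longrightarrow> 0 \<le> error_const C e"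
  unfolding error_const_def remainder_const_def abs_moment3_def
  by (intro add_nonneg_nonneg mult_nonneg_nonneg) auto

text \<open>The supermartingale inequality, up to the error \<open>w\<close> per step. The independence of the new increments
from the past is expressed by Fubini's theorem: the integrals over the last coordinates of both
sequences are moved inside, where \<open>expected_potential_step\<close> bounds them.\<close>

lemma expected_corner_energy:
  fixes C e \<sigma> :: real
  assumes e: "0 < e" "e \<le> 1" and C: "0 \<le> C" and s: "0 \<le> fst s" "0 \<le> snd s" and \<sigma>: "0 < \<sigma>" "\<sigma> \<le> 1"
  defines "m \<equiv> C * \<sigma>\<^sup>2" and "w \<equiv> drift_const C * \<sigma>\<^sup>2 + error_const C e * \<sigma> ^ 3"
  shows "(\<integral>\<^sup>+\<xi>. \<integral>\<^sup>+\<eta>. corner_energy C e (stopped_chain m e s \<xi> \<eta> k)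
       \<partial>PiM {..<k} (\<lambda>_. gaussian \<sigma>) \<partial>PiM {..<k} (\<lambda>_. gaussian \<sigma>))
     \<le> ennreal (potential C e (fst s) (snd s) + k * w)"
proof (induction k)
  case 0
  show ?case by (simp add: PiM_empty nn_integral_count_space_finite corner_energy_def)
next
  case (Suc k)
  interpret G: prob_space "gaussian \<sigma>" by (rule prob_space_gaussian[OF \<sigma>(1)])
  interpret product_sigma_finite "\<lambda>_::nat. gaussian \<sigma>" by (simp add: product_sigma_finite_def G.sigma_finite_measure_axioms)
  let ?P = "\<lambda>k. PiM {..<k} (\<lambda>_. gaussian \<sigma>)" and ?S = "stopped_chain m e s" and ?f = "corner_energy C e"
  interpret Pk: prob_space "?P k" by (rule prob_space_PiM) (rule prob_space_gaussian[OF \<sigma>(1)])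
  interpret PS: prob_space "?P (Suc k)" by (rule prob_space_PiM) (rule prob_space_gaussian[OF \<sigma>(1)])
  interpret GP: pair_sigma_finite "gaussian \<sigma>" "?P k" ..
  define step where "step z \<xi> \<eta> = (if z \<in> near_corner e then z
      else (max 0 (fst z - (m + \<xi>)), max 0 (snd z - (m - \<eta>))))" for z :: "real \<times> real" and \<xi> \<eta>
  have w: "0 \<le> w" using e C \<sigma> drift_const_nonneg[OF C] error_const_nonneg[OF e(1) C] by (simp add: w_def)
  have ins: "{..<Suc k} = insert k {..<k}" by auto
  have S_Suc: "?S (x(k := \<xi>)) (y(k := \<eta>)) (Suc k) = step (?S x y k) \<xi> \<eta>" for x y \<xi> \<eta>
  proof -
    have "?S (x(k := \<xi>)) (y(k := \<eta>)) k = ?S x y k" by (rule stopped_chain_cong) auto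
    then show ?thesis by (simp add: step_def Let_def case_prod_beta')
  qed
  have one_step: "(\<integral>\<^sup>+\<xi>. \<integral>\<^sup>+\<eta>. ?f (step z \<xi> \<eta>) \<partial>gaussian \<sigma> \<partial>gaussian \<sigma>) \<le> ?f z + ennreal w"
    if z: "0 \<le> fst z" "0 \<le> snd z" for z
  proof (cases "z \<in> near_corner e")
    case True
    then show ?thesis by (simp add: step_def G.emeasure_space_1[simplified])
  next
    case False
    then have "(\<integral>\<^sup>+\<xi>. \<integral>\<^sup>+\<eta>. ?f (step z \<xi> \<eta>) \<partial>gaussian \<sigma> \<partial>gaussian \<sigma>)
      \<le> ennreal (potential C e (fst z) (snd z) + drift_const C * \<sigma>\<^sup>2 + error_const C e * \<sigma> ^ 3)"
      using expected_potential_step[OF e C z \<sigma>] by (simp add: step_def corner_energy_def m_def)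
    also have "\<dots> = ?f z + ennreal w"
      using potential_nonneg[OF e C z] w
      by (simp add: corner_energy_def w_def ennreal_plus[symmetric] add.assoc del: ennreal_plus)
    finally show ?thesis .
  qed
  have meas_S: "(\<lambda>(x, y). ?f (?S x y j)) \<in> borel_measurable (?P n \<Otimes>\<^sub>M ?P n)" if "j \<le> n" for j n
    using measurable_compose[OF measurable_stopped_chain[OF that] measurable_corner_energy]
    by (simp add: case_prod_beta')
  have meas_Sk: "(\<lambda>(x, y). ?S x y k) \<in> ?P k \<Otimes>\<^sub>M ?P k \<rightarrow>\<^sub>M borel \<Otimes>\<^sub>M borel"
    by (rule measurable_stopped_chain) simp
  have meas_step: "(\<lambda>((z, \<xi>), \<eta>). ?f (step z \<xi> \<eta>))
      \<in> borel_measurable (((borel \<Otimes>\<^sub>M borel) \<Otimes>\<^sub>M gaussian \<sigma>) \<Otimes>\<^sub>M gaussian \<sigma>)"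
    unfolding step_def case_prod_beta' by measurable
  have "(\<integral>\<^sup>+\<xi>. \<integral>\<^sup>+\<eta>. ?f (?S \<xi> \<eta> (Suc k)) \<partial>?P (Suc k) \<partial>?P (Suc k))
      = (\<integral>\<^sup>+x. \<integral>\<^sup>+\<xi>. \<integral>\<^sup>+\<eta>. ?f (?S (x(k := \<xi>)) \<eta> (Suc k)) \<partial>?P (Suc k) \<partial>gaussian \<sigma> \<partial>?P k)"
    using PS.borel_measurable_nn_integral[OF meas_S[of "Suc k" "Suc k"]]
    unfolding ins by (subst product_nn_integral_insert) (auto simp: ins)
  also have "\<dots> = (\<integral>\<^sup>+x. \<integral>\<^sup>+\<xi>. \<integral>\<^sup>+y. \<integral>\<^sup>+\<eta>. ?f (step (?S x y k) \<xi> \<eta>) \<partial>gaussian \<sigma> \<partial>?P k \<partial>gaussian \<sigma> \<partial>?P k)"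
  proof (intro nn_integral_cong)
    fix x \<xi> assume "x \<in> space (?P k)"
    then have "x(k := \<xi>) \<in> space (?P (Suc k))"
      by (auto simp: space_PiM PiE_iff extensional_def)
    then have "(\<lambda>y. ?f (?S (x(k := \<xi>)) y (Suc k))) \<in> borel_measurable (?P (Suc k))"
      using measurable_compose[OF measurable_Pair1' meas_S[of "Suc k" "Suc k"]] by simp
    then show "(\<integral>\<^sup>+\<eta>. ?f (?S (x(k := \<xi>)) \<eta> (Suc k)) \<partial>?P (Suc k))
        = (\<integral>\<^sup>+y. \<integral>\<^sup>+\<eta>. ?f (step (?S x y k) \<xi> \<eta>) \<partial>gaussian \<sigma> \<partial>?P k)"
      unfolding ins by (subst product_nn_integral_insert) (auto simp: S_Suc simp del: stopped_chain.simps)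
  qed
  also have "\<dots> = (\<integral>\<^sup>+x. \<integral>\<^sup>+y. \<integral>\<^sup>+\<xi>. \<integral>\<^sup>+\<eta>. ?f (step (?S x y k) \<xi> \<eta>) \<partial>gaussian \<sigma> \<partial>gaussian \<sigma> \<partial>?P k \<partial>?P k)"
  proof (intro nn_integral_cong)
    fix x assume x: "x \<in> space (?P k)"
    have [measurable]: "(\<lambda>y. ?S x y k) \<in> ?P k \<rightarrow>\<^sub>M borel \<Otimes>\<^sub>M borel"
      using measurable_compose[OF measurable_Pair1'[OF x] meas_Sk] by simp
    have "(\<lambda>p. ?f (step (?S x (snd (fst p)) k) (fst (fst p)) (snd p)))
        \<in> borel_measurable ((gaussian \<sigma> \<Otimes>\<^sub>M ?P k) \<Otimes>\<^sub>M gaussian \<sigma>)"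
      unfolding step_def by measurable
    then have "(\<lambda>(\<xi>, y). \<integral>\<^sup>+\<eta>. ?f (step (?S x y k) \<xi> \<eta>) \<partial>gaussian \<sigma>)
        \<in> borel_measurable (gaussian \<sigma> \<Otimes>\<^sub>M ?P k)"
      unfolding case_prod_beta' by (intro G.borel_measurable_nn_integral) (simp add: case_prod_beta')
    then show "(\<integral>\<^sup>+\<xi>. \<integral>\<^sup>+y. \<integral>\<^sup>+\<eta>. ?f (step (?S x y k) \<xi> \<eta>) \<partial>gaussian \<sigma> \<partial>?P k \<partial>gaussian \<sigma>)
      = (\<integral>\<^sup>+y. \<integral>\<^sup>+\<xi>. \<integral>\<^sup>+\<eta>. ?f (step (?S x y k) \<xi> \<eta>) \<partial>gaussian \<sigma> \<partial>gaussian \<sigma> \<partial>?P k)"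
      by (rule GP.Fubini'[symmetric])
  qed
  also have "\<dots> \<le> (\<integral>\<^sup>+x. \<integral>\<^sup>+y. ?f (?S x y k) + ennreal w \<partial>?P k \<partial>?P k)"
    using stopped_chain_nonneg[OF s] by (intro nn_integral_mono one_step) auto
  also have "\<dots> = (\<integral>\<^sup>+x. (\<integral>\<^sup>+y. ?f (?S x y k) \<partial>?P k) + ennreal w \<partial>?P k)"
  proof (intro nn_integral_cong)
    fix x assume x: "x \<in> space (?P k)"
    have "(\<lambda>y. ?f (?S x y k)) \<in> borel_measurable (?P k)"
      using measurable_compose[OF measurable_Pair1'[OF x] meas_S[of k k]] by simp
    then show "(\<integral>\<^sup>+y. ?f (?S x y k) + ennreal w \<partial>?P k) = (\<integral>\<^sup>+y. ?f (?S x y k) \<partial>?P k) + ennreal w"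
      by (subst nn_integral_add) (auto simp: Pk.emeasure_space_1)
  qed
  also have "\<dots> = (\<integral>\<^sup>+x. (\<integral>\<^sup>+y. ?f (?S x y k) \<partial>?P k) \<partial>?P k) + ennreal w"
    using Pk.borel_measurable_nn_integral[OF meas_S[of k k]]
    by (subst nn_integral_add) (auto simp: Pk.emeasure_space_1)
  also have "\<dots> \<le> ennreal (potential C e (fst s) (snd s) + k * w) + ennreal w"
    by (intro add_right_mono Suc.IH)
  also have "\<dots> = ennreal (potential C e (fst s) (snd s) + Suc k * w)"
    using potential_nonneg[OF e C s] w
    by (simp add: ennreal_plus[symmetric] algebra_simps del: ennreal_plus)
  finally show ?case .
qed

section \<open>Brownian motions along a grid\<close>

definition increments :: "(real \<Rightarrow> real) \<Rightarrow> real \<Rightarrow> nat \<Rightarrow> real" where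
  "increments b \<delta> i = b (real (Suc i) * \<delta>) - b (real i * \<delta>)"

context prob_space
begin

lemma brownian_increments_law:
  assumes B: "brownian_motion B" and \<delta>: "0 < \<delta>" and n: "0 < n"
  shows "(\<lambda>\<omega>. \<lambda>i\<in>{..<n}. increments (\<lambda>t. B t \<omega>) \<delta> i) \<in> M \<rightarrow>\<^sub>M PiM {..<n} (\<lambda>_. borel)"
    and "distr M (PiM {..<n} (\<lambda>_. borel)) (\<lambda>\<omega>. \<lambda>i\<in>{..<n}. increments (\<lambda>t. B t \<omega>) \<delta> i)
      = PiM {..<n} (\<lambda>_. gaussian (sqrt \<delta>))"
proof -
  let ?X = "\<lambda>i \<omega>. increments (\<lambda>t. B t \<omega>) \<delta> i"
  have rvB: "random_variable borel (B t)" if "0 \<le> t" for t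
    using B that by (simp add: brownian_motion_def)
  have rv: "random_variable borel (?X i)" for i
    unfolding increments_def using \<delta> by (intro borel_measurable_diff rvB) auto
  then show "(\<lambda>\<omega>. \<lambda>i\<in>{..<n}. ?X i \<omega>) \<in> M \<rightarrow>\<^sub>M PiM {..<n} (\<lambda>_. borel)"
    by (intro measurable_restrict)
  have "indep_vars (\<lambda>_. borel) (\<lambda>i \<omega>. B (real (Suc i) * \<delta>) \<omega> - B (real i * \<delta>) \<omega>) {..<n}"
    using B[unfolded brownian_motion_def, THEN conjunct2, THEN conjunct2, THEN conjunct1, rule_format,
        of "\<lambda>i. real i * \<delta>" n] \<delta> by (auto intro: mult_right_mono)
  then have "indep_vars (\<lambda>_. borel) ?X {..<n}" by (simp add: increments_def)
  then have "distr M (PiM {..<n} (\<lambda>_. borel)) (\<lambda>\<omega>. \<lambda>i\<in>{..<n}. ?X i \<omega>)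
      = PiM {..<n} (\<lambda>i. distr M borel (?X i))"
    using rv n by (subst (asm) indep_vars_iff_distr_eq_PiM') auto
  also have "\<dots> = PiM {..<n} (\<lambda>_. gaussian (sqrt \<delta>))"
  proof (intro PiM_cong refl)
    fix i
    have "distributed M lborel (\<lambda>\<omega>. B (real (Suc i) * \<delta>) \<omega> - B (real i * \<delta>) \<omega>)
      (\<lambda>z. ennreal (normal_density 0 (sqrt (real (Suc i) * \<delta> - real i * \<delta>)) z))"
      using B \<delta> by (auto simp: brownian_motion_def)
    moreover have "real (Suc i) * \<delta> - real i * \<delta> = \<delta>" by (simp add: algebra_simps)
    ultimately have "distr M lborel (?X i) = gaussian (sqrt \<delta>)"
      by (simp add: distributed_def increments_def gaussian_def)
    moreover have "distr M borel (?X i) = distr M lborel (?X i)" by (intro distr_cong) auto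
    ultimately show "distr M borel (?X i) = gaussian (sqrt \<delta>)" by simp
  qed
  finally show "distr M (PiM {..<n} (\<lambda>_. borel)) (\<lambda>\<omega>. \<lambda>i\<in>{..<n}. ?X i \<omega>)
      = PiM {..<n} (\<lambda>_. gaussian (sqrt \<delta>))" .
qed

lemma joint_increments_law:
  assumes A: "brownian_motion A" and B: "brownian_motion B" and AB: "indep_processes A B"
    and \<delta>: "0 < \<delta>" and n: "0 < n"
  defines "X \<equiv> (\<lambda>\<omega>. \<lambda>i\<in>{..<n}. increments (\<lambda>t. A t \<omega>) \<delta> i)"
    and "Y \<equiv> (\<lambda>\<omega>. \<lambda>i\<in>{..<n}. increments (\<lambda>t. B t \<omega>) \<delta> i)"
  shows "distr M (PiM {..<n} (\<lambda>_. borel) \<Otimes>\<^sub>M PiM {..<n} (\<lambda>_. borel)) (\<lambda>\<omega>. (X \<omega>, Y \<omega>))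
      = PiM {..<n} (\<lambda>_. gaussian (sqrt \<delta>)) \<Otimes>\<^sub>M PiM {..<n} (\<lambda>_. gaussian (sqrt \<delta>))"
proof -
  define g where "g f = (\<lambda>i\<in>{..<n}. increments f \<delta> i)" for f :: "real \<Rightarrow> real"
  have g: "g \<in> PiM {0..} (\<lambda>_. borel) \<rightarrow>\<^sub>M PiM {..<n} (\<lambda>_. borel)"
    unfolding g_def increments_def using \<delta>
    by (intro measurable_restrict borel_measurable_diff measurable_component_singleton) auto
  have eq: "g \<circ> (\<lambda>\<omega>. \<lambda>t\<in>{0..}. A t \<omega>) = X" "g \<circ> (\<lambda>\<omega>. \<lambda>t\<in>{0..}. B t \<omega>) = Y"
    using \<delta> by (auto simp: fun_eq_iff g_def X_def Y_def increments_def restrict_def)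
  have "indep_var (PiM {..<n} (\<lambda>_. borel)) X (PiM {..<n} (\<lambda>_. borel)) Y"
    using indep_var_compose[OF AB[unfolded indep_processes_def] g g] unfolding eq .
  then show ?thesis
    unfolding indep_var_distribution_eq
    by (simp add: X_def Y_def brownian_increments_law[OF A \<delta> n] brownian_increments_law[OF B \<delta> n])
qed

text \<open>Markov's inequality for the corner energy at time \<open>n\<close>. With \<open>n * \<delta>\<close> fixed, the bound is of order
\<open>1 / ln (1 / (2 e))\<close> as \<open>\<delta> \<rightarrow> 0\<close>.\<close>

lemma prob_chain_near_corner:
  assumes A: "brownian_motion A" and B: "brownian_motion B" and AB: "indep_processes A B"
    and e: "0 < e" "e < 1 / 2" and C: "0 \<le> C" and s: "0 \<le> fst s" "0 \<le> snd s"
    and \<delta>: "0 < \<delta>" "\<delta> \<le> 1" and n: "0 < n"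
  defines "hit \<equiv> {\<omega> \<in> space M. stopped_chain (C * \<delta>) e s (increments (\<lambda>t. A t \<omega>) \<delta>)
      (increments (\<lambda>t. B t \<omega>) \<delta>) n \<in> near_corner e}"
  shows "hit \<in> events"
    and "prob hit \<le> (potential C e (fst s) (snd s)
      + real n * \<delta> * (drift_const C + error_const C e * sqrt \<delta>)) / ln (1 / (2 * e))"
proof -
  define X Y where "X = (\<lambda>\<omega>. \<lambda>i\<in>{..<n}. increments (\<lambda>t. A t \<omega>) \<delta> i)"
    and "Y = (\<lambda>\<omega>. \<lambda>i\<in>{..<n}. increments (\<lambda>t. B t \<omega>) \<delta> i)"
  define H where "H = ln (1 / (2 * e))"
  let ?\<sigma> = "sqrt \<delta>" and ?P = "PiM {..<n} (\<lambda>_. gaussian (sqrt \<delta>))"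
  let ?B = "PiM {..<n} (\<lambda>_. borel :: real measure)"
  let ?S = "\<lambda>x y. stopped_chain (C * \<delta>) e s x y n"
  interpret P: prob_space ?P using \<delta> by (intro prob_space_PiM prob_space_gaussian) auto
  have H: "0 < H" unfolding H_def using e by (intro ln_gt_zero) (simp add: field_simps)
  have hit_eq: "hit = {\<omega> \<in> space M. ?S (X \<omega>) (Y \<omega>) \<in> near_corner e}"
    unfolding hit_def X_def Y_def
    by (intro Collect_cong conj_cong refl arg_cong2[where f="(\<in>)"] stopped_chain_cong) auto
  have sets_P: "sets ?P = sets ?B" by (intro sets_PiM_cong) auto
  have XY [measurable]: "X \<in> M \<rightarrow>\<^sub>M ?P" "Y \<in> M \<rightarrow>\<^sub>M ?P"
    using brownian_increments_law(1)[OF A \<delta>(1) n] brownian_increments_law(1)[OF B \<delta>(1) n]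
    unfolding X_def Y_def by (simp_all cong: measurable_cong_sets add: measurable_cong_sets[OF refl sets_P])
  have S: "(\<lambda>(x, y). ?S x y) \<in> ?P \<Otimes>\<^sub>M ?P \<rightarrow>\<^sub>M borel \<Otimes>\<^sub>M borel"
    by (rule measurable_stopped_chain) simp
  have [measurable]: "(\<lambda>\<omega>. ?S (X \<omega>) (Y \<omega>)) \<in> M \<rightarrow>\<^sub>M borel \<Otimes>\<^sub>M borel"
    using measurable_compose[OF measurable_Pair[OF XY] S] by simp
  show ev: "hit \<in> events" unfolding hit_eq by measurable
  have law: "distr M (?P \<Otimes>\<^sub>M ?P) (\<lambda>\<omega>. (X \<omega>, Y \<omega>)) = ?P \<Otimes>\<^sub>M ?P"
    using joint_increments_law[OF A B AB \<delta>(1) n]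
    by (subst (asm) distr_cong[OF refl sets_pair_measure_cong[OF sets_P[symmetric] sets_P[symmetric]] refl])
      (simp add: X_def Y_def)
  have "ennreal H * emeasure M hit = (\<integral>\<^sup>+\<omega>. ennreal H * indicator hit \<omega> \<partial>M)"
    using ev by (simp add: nn_integral_cmult)
  also have "\<dots> \<le> (\<integral>\<^sup>+\<omega>. corner_energy C e (?S (X \<omega>) (Y \<omega>)) \<partial>M)"
  proof (rule nn_integral_mono)
    fix \<omega> assume "\<omega> \<in> space M"
    show "ennreal H * indicator hit \<omega> \<le> corner_energy C e (?S (X \<omega>) (Y \<omega>))"
    proof (cases "\<omega> \<in> hit")
      case True
      then have "fst (?S (X \<omega>) (Y \<omega>)) \<le> e" "snd (?S (X \<omega>) (Y \<omega>)) \<le> e"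
        by (auto simp: hit_eq near_corner_def mem_Times_iff)
      then have "H \<le> potential C e (fst (?S (X \<omega>) (Y \<omega>))) (snd (?S (X \<omega>) (Y \<omega>)))"
        unfolding H_def using stopped_chain_nonneg[OF s] e C by (intro potential_near_corner) auto
      then show ?thesis using True by (simp add: corner_energy_def ennreal_leI)
    qed simp
  qed
  also have "\<dots> = (\<integral>\<^sup>+z. corner_energy C e (?S (fst z) (snd z)) \<partial>distr M (?P \<Otimes>\<^sub>M ?P) (\<lambda>\<omega>. (X \<omega>, Y \<omega>)))"
    using measurable_compose[OF S measurable_corner_energy]
    by (subst nn_integral_distr) (auto simp: case_prod_beta')
  also have "\<dots> = (\<integral>\<^sup>+x. \<integral>\<^sup>+y. corner_energy C e (?S x y) \<partial>?P \<partial>?P)"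
    unfolding law using measurable_compose[OF S measurable_corner_energy]
    by (subst P.nn_integral_fst[symmetric]) (auto simp: case_prod_beta')
  also have "\<dots> \<le> ennreal (potential C e (fst s) (snd s)
      + real n * (drift_const C * ?\<sigma>\<^sup>2 + error_const C e * ?\<sigma> ^ 3))"
    using expected_corner_energy[of e C s ?\<sigma> n] e C s \<delta> by simp
  also have "real n * (drift_const C * ?\<sigma>\<^sup>2 + error_const C e * ?\<sigma> ^ 3)
      = real n * \<delta> * (drift_const C + error_const C e * sqrt \<delta>)"
    using \<delta> by (simp add: power3_eq_cube algebra_simps)
  finally have "ennreal (H * prob hit) \<le> ennreal (potential C e (fst s) (snd s)
      + real n * \<delta> * (drift_const C + error_const C e * sqrt \<delta>))" (is "_ \<le> ennreal ?R")
    using H by (simp add: emeasure_eq_measure ennreal_mult)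
  moreover have "0 \<le> ?R"
    using potential_nonneg[of e C "fst s" "snd s"] drift_const_nonneg error_const_nonneg e C s \<delta> by simp
  ultimately have "H * prob hit \<le> ?R" by (simp add: ennreal_le_iff)
  then show "prob hit \<le> ?R / ln (1 / (2 * e))"
    using H unfolding H_def by (simp add: field_simps)
qed

end

text \<open>The second path enters with the opposite sign, because \<open>X2\<close> is pushed upwards and \<open>X1\<close> downwards. In
the application \<open>s = (y, x - y)\<close> consists of the initial distances of \<open>Y\<close> from the two paths.\<close>

definition simultaneous_record :: "real \<Rightarrow> real \<times> real \<Rightarrow> (real \<Rightarrow> real) \<Rightarrow> (real \<Rightarrow> real) \<Rightarrow> real \<Rightarrow> bool" where
  "simultaneous_record C s b1 b2 t \<longleftrightarrow>
     fst s \<le> b1 t + C * t \<and> snd s \<le> C * t - b2 t \<and>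
     (\<forall>r\<in>{0..t}. b1 r + C * r \<le> b1 t + C * t \<and> C * r - b2 r \<le> C * t - b2 t)"

text \<open>Up to the time \<open>t\<close> of the record, the distance from the running maximum along the grid is at most the
amount by which the path still has to rise until \<open>t\<close>; this bound survives the reflection because that
amount is nonnegative. At the last grid point before \<open>t\<close> it is small by continuity.\<close>

lemma chain_near_corner_of_record:
  assumes cont: "continuous_on {0..} b1" "continuous_on {0..} b2" and b0: "b1 0 = 0" "b2 0 = 0"
    and T: "0 < T" and t: "0 \<le> t" "t \<le> T" and rec: "simultaneous_record C s b1 b2 t" and e: "0 < e"
  shows "\<forall>\<^sub>F n in sequentially.
    stopped_chain (C * (T / n)) e s (increments b1 (T / n)) (increments b2 (T / n)) n \<in> near_corner e"
proof -
  define w1 w2 where "w1 r = b1 r + C * r" and "w2 r = C * r - b2 r" for r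
  have cw: "continuous_on {0..} w1" "continuous_on {0..} w2"
    unfolding w1_def w2_def by (intro continuous_intros cont)+
  obtain d1 where d1: "0 < d1" "\<And>r. 0 \<le> r \<Longrightarrow> dist r t < d1 \<Longrightarrow> dist (w1 r) (w1 t) < e"
    using cw(1) t e unfolding continuous_on_iff by (metis atLeast_iff)
  obtain d2 where d2: "0 < d2" "\<And>r. 0 \<le> r \<Longrightarrow> dist r t < d2 \<Longrightarrow> dist (w2 r) (w2 t) < e"
    using cw(2) t e unfolding continuous_on_iff by (metis atLeast_iff)
  have "(\<lambda>n. T / real n) \<longlonglongrightarrow> 0" by (rule lim_const_over_n)
  then have "\<forall>\<^sub>F n in sequentially. T / real n < min d1 d2"
    using d1(1) d2(1) by (intro order_tendstoD) auto
  then show ?thesis using eventually_gt_at_top[of 0]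
  proof eventually_elim
    case (elim n)
    define \<delta> where "\<delta> = T / real n"
    have \<delta>: "0 < \<delta>" "\<delta> < d1" "\<delta> < d2" using elim T by (auto simp: \<delta>_def)
    let ?S = "stopped_chain (C * \<delta>) e s (increments b1 \<delta>) (increments b2 \<delta>)"
    have bound: "?S k \<in> near_corner e
        \<or> fst (?S k) \<le> w1 t - w1 (real k * \<delta>) \<and> snd (?S k) \<le> w2 t - w2 (real k * \<delta>)" if "real k * \<delta> \<le> t" for k
      using that
    proof (induction k)
      case 0
      then show ?case using rec b0 by (simp add: simultaneous_record_def w1_def w2_def)
    next
      case (Suc k)
      have "real k * \<delta> \<le> real (Suc k) * \<delta>" using \<delta> by (intro mult_right_mono) auto
      then have IH: "?S k \<in> near_corner e
        \<or> fst (?S k) \<le> w1 t - w1 (real k * \<delta>) \<and> snd (?S k) \<le> w2 t - w2 (real k * \<delta>)"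
        using Suc by linarith
      have inc: "C * \<delta> + increments b1 \<delta> k = w1 (real (Suc k) * \<delta>) - w1 (real k * \<delta>)"
        "C * \<delta> - increments b2 \<delta> k = w2 (real (Suc k) * \<delta>) - w2 (real k * \<delta>)"
        by (simp_all add: increments_def w1_def w2_def algebra_simps)
      have "real (Suc k) * \<delta> \<in> {0..t}" using Suc.prems \<delta> by simp
      then have "w1 (real (Suc k) * \<delta>) \<le> w1 t" "w2 (real (Suc k) * \<delta>) \<le> w2 t"
        using rec unfolding simultaneous_record_def w1_def w2_def by blast+
      then show ?case using IH
        by (auto simp: Let_def inc split: prod.splits)
    qed
    define k where "k = nat \<lfloor>t / \<delta>\<rfloor>"
    have k0: "0 \<le> \<lfloor>t / \<delta>\<rfloor>" using t \<delta> by simp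
    then have "real k \<le> t / \<delta>" "t / \<delta> < real k + 1" unfolding k_def by linarith+
    then have k: "real k * \<delta> \<le> t" "t < real k * \<delta> + \<delta>" using \<delta> by (auto simp: field_simps)
    have kn: "k \<le> n"
    proof -
      have "real k * \<delta> \<le> real n * \<delta>" using k t elim by (simp add: \<delta>_def)
      then show ?thesis using \<delta> by simp
    qed
    have "dist (w1 (real k * \<delta>)) (w1 t) < e" "dist (w2 (real k * \<delta>)) (w2 t) < e"
      using d1(2)[of "real k * \<delta>"] d2(2)[of "real k * \<delta>"] k \<delta> by (auto simp: dist_real_def)
    with bound[OF k(1)] have "?S k \<in> near_corner e"
      by (auto simp: near_corner_def mem_Times_iff dist_real_def)
    then show ?case unfolding \<delta>_def[symmetric] by (rule stopped_chain_stays[OF _ kn])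
  qed
qed

section \<open>Independent Brownian motions have no simultaneous records\<close>

lemma (in prob_space) prob_eventually_le:
  assumes ev: "\<And>n. A n \<in> events" and le: "\<And>n. prob (A n) \<le> c n" and lim: "c \<longlonglongrightarrow> l"
  shows "{\<omega> \<in> space M. \<forall>\<^sub>F n in sequentially. \<omega> \<in> A n} \<in> events"
    and "prob {\<omega> \<in> space M. \<forall>\<^sub>F n in sequentially. \<omega> \<in> A n} \<le> l"
proof -
  define D where "D k = {\<omega> \<in> space M. \<forall>n\<ge>k. \<omega> \<in> A n}" for k
  have D [measurable]: "D k \<in> events" for k
    unfolding D_def using ev by measurable
  have eq: "{\<omega> \<in> space M. \<forall>\<^sub>F n in sequentially. \<omega> \<in> A n} = (\<Union>k. D k)"
    by (auto simp: D_def eventually_sequentially)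
  show "{\<omega> \<in> space M. \<forall>\<^sub>F n in sequentially. \<omega> \<in> A n} \<in> events" unfolding eq by measurable
  have "incseq D" by (auto simp: D_def incseq_def)
  then have "(\<lambda>k. prob (D k)) \<longlonglongrightarrow> prob (\<Union>k. D k)"
    using D by (intro finite_Lim_measure_incseq) auto
  moreover have "prob (D k) \<le> c k" for k
    using finite_measure_mono[of "D k" "A k"] ev le[of k] by (force simp: D_def)
  ultimately show "prob {\<omega> \<in> space M. \<forall>\<^sub>F n in sequentially. \<omega> \<in> A n} \<le> l"
    unfolding eq using lim by (intro LIMSEQ_le) auto
qed

text \<open>The mesh tends to zero first, for fixed \<open>e\<close>, and this removes the error constant that depends on \<open>e\<close>.
Only then the bound \<open>a / ln (1 / (2 e))\<close> is used along a sequence \<open>e \<rightarrow> 0\<close>.\<close>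

lemma (in prob_space) AE_no_simultaneous_record:
  assumes A: "brownian_motion A" and B: "brownian_motion B" and AB: "indep_processes A B"
    and C: "0 \<le> C" and s: "0 \<le> fst s" "0 \<le> snd s" "0 < fst s + snd s" and T: "0 < T"
  shows "AE \<omega> in M. \<forall>t\<in>{0..T}. \<not> simultaneous_record C s (\<lambda>t. A t \<omega>) (\<lambda>t. B t \<omega>) t"
proof -
  define hit where "hit e n = {\<omega> \<in> space M. stopped_chain (C * (T / real n)) e s
     (increments (\<lambda>t. A t \<omega>) (T / real n)) (increments (\<lambda>t. B t \<omega>) (T / real n)) n \<in> near_corner e}"
    for e and n :: nat
  define ev where "ev e = {\<omega> \<in> space M. \<forall>\<^sub>F n in sequentially. \<omega> \<in> hit e n}" for e
  define a where "a = (fst s)\<^sup>2 + (snd s)\<^sup>2 - ln (sqrt ((fst s)\<^sup>2 + (snd s)\<^sup>2)) + potential_offset C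
     + T * drift_const C"
  \<comment> \<open>Grids with fewer than \<open>N\<close> points are skipped to have a mesh of at most one.\<close>
  obtain N :: nat where N: "0 < N" "T \<le> real N"
  proof
    show "0 < nat \<lceil>T\<rceil>" "T \<le> real (nat \<lceil>T\<rceil>)" using T by linarith+
  qed
  have ev_le: "ev e \<in> events \<and> prob (ev e) \<le> a / ln (1 / (2 * e))" if e: "0 < e" "e < 1 / 2" for e
  proof -
    define c where "c n = (a + T * (error_const C e * sqrt (T / real (n + N)))) / ln (1 / (2 * e))" for n
    have H: "0 < ln (1 / (2 * e))" using e by (intro ln_gt_zero) (simp add: field_simps)
    define q where "q n = sqrt (T / real (n + N))" for n
    have "(\<lambda>n. T / real (n + N)) \<longlonglongrightarrow> 0"
      by (rule LIMSEQ_ignore_initial_segment[OF lim_const_over_n])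
    then have "q \<longlonglongrightarrow> sqrt 0" unfolding q_def by (rule tendsto_real_sqrt)
    then have "(\<lambda>n. (a + T * (error_const C e * q n)) / ln (1 / (2 * e)))
        \<longlonglongrightarrow> (a + T * (error_const C e * sqrt 0)) / ln (1 / (2 * e))"
      using H by (intro tendsto_intros) auto
    then have lim: "c \<longlonglongrightarrow> a / ln (1 / (2 * e))"
      by (simp add: c_def[abs_def] q_def[abs_def])
    have hit: "hit e (n + N) \<in> events \<and> prob (hit e (n + N)) \<le> c n" for n
    proof -
      have n: "0 < n + N" "0 < T / real (n + N)" "T / real (n + N) \<le> 1" using N T by (auto simp: field_simps)
      note p = prob_chain_near_corner[OF A B AB e C s(1,2) n(2,3,1)]
      have "potential C e (fst s) (snd s) + real (n + N) * (T / real (n + N)) *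
          (drift_const C + error_const C e * sqrt (T / real (n + N)))
        \<le> a + T * (error_const C e * sqrt (T / real (n + N)))"
      proof -
        have "real (n + N) * (T / real (n + N)) = T" using n(1) by auto
        then show ?thesis
          using potential_le_start[OF e(1) C s] by (simp only: a_def distrib_left)
      qed
      then have "prob (hit e (n + N)) \<le> c n"
        using p(2) H unfolding hit_def c_def by (meson divide_right_mono less_imp_le order_trans)
      then show ?thesis using p(1) unfolding hit_def by simp
    qed
    have "ev e = {\<omega> \<in> space M. \<forall>\<^sub>F n in sequentially. \<omega> \<in> hit e (n + N)}"
      unfolding ev_def
      using eventually_sequentially_seg[of "\<lambda>n. \<omega> \<in> hit e n" N for \<omega>] by simp
    then show ?thesis
      using prob_eventually_le[of "\<lambda>n. hit e (n + N)" c, OF _ _ lim] hit by simp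
  qed
  \<comment> \<open>chosen such that \<open>ln (1 / (2 * e j)) = j + 1\<close>\<close>
  define e where "e j = exp (- real (Suc j)) / 2" for j
  have e: "0 < e j" "e j < 1 / 2" "ln (1 / (2 * e j)) = real (Suc j)" for j
    by (auto simp: e_def exp_minus ln_div)
  define N0 where "N0 = (\<Inter>j. ev (e j))"
  have N0: "N0 \<in> events" unfolding N0_def using ev_le[OF e(1,2)] by auto
  have "prob N0 \<le> a / real (Suc j)" for j
    using finite_measure_mono[of N0 "ev (e j)"] ev_le[OF e(1,2), of j] unfolding e(3) N0_def by force
  moreover have "(\<lambda>j. a / real (Suc j)) \<longlonglongrightarrow> 0" by (rule LIMSEQ_Suc[OF lim_const_over_n])
  ultimately have "prob N0 \<le> 0" by (intro LIMSEQ_le_const[of _ 0 "prob N0"]) auto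
  then have "N0 \<in> null_sets M" using N0 by (simp add: null_sets_def emeasure_eq_measure measure_le_0_iff)
  then have "AE \<omega> in M. \<omega> \<notin> N0" by (rule AE_not_in)
  moreover have "AE \<omega> in M. A 0 \<omega> = 0" "AE \<omega> in M. B 0 \<omega> = 0"
    "AE \<omega> in M. continuous_on {0..} (\<lambda>t. A t \<omega>)" "AE \<omega> in M. continuous_on {0..} (\<lambda>t. B t \<omega>)"
    using A B by (auto simp: brownian_motion_def)
  ultimately show ?thesis using AE_space
  proof eventually_elim
    case (elim \<omega>)
    show ?case
    proof (intro ballI notI)
      fix t assume t: "t \<in> {0..T}" and rec: "simultaneous_record C s (\<lambda>t. A t \<omega>) (\<lambda>t. B t \<omega>) t"
      have "\<omega> \<in> ev (e j)" for j
        using chain_near_corner_of_record[OF elim(4,5,2,3) T _ _ rec e(1)[of j]] t elim(6)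
        by (simp add: ev_def hit_def)
      then show False using elim(1) by (simp add: N0_def)
    qed
  qed
qed

section \<open>Collisions are simultaneous records\<close>

text \<open>The pathwise reduction. The constant \<open>C\<close> is a bound of the velocity on the compact interval up to the
collision; it is taken to be a natural number so that countably many null sets cover all paths.\<close>

lemma simultaneous_record_of_collision:
  assumes sol: "path_solution x y v K b1 b2 l1 l2 \<tau>" and fin: "\<tau> \<noteq> \<infinity>"
  shows "\<exists>C t. 0 \<le> t \<and> simultaneous_record (real C) (y, x - y) b1 b2 t"
proof -
  define I where "I = times_upto \<tau>"
  let ?X1 = "path_X1 b1 l1" and ?X2 = "path_X2 x b2 l2" and ?Y = "path_Y y v K l1 l2" and ?V = "path_V v K l1 l2"
  note S = sol[unfolded path_solution_def Let_def, folded I_def]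
  have inf: "\<tau> = (INF t\<in>{t\<in>I. ?X1 t = ?X2 t}. ereal t)" using S by blast
  have "{t\<in>I. ?X1 t = ?X2 t} \<noteq> {}"
  proof
    assume empty: "{t\<in>I. ?X1 t = ?X2 t} = {}"
    have "\<tau> = \<infinity>" by (subst inf, subst empty) (simp add: top_ereal_def)
    with fin show False ..
  qed
  then obtain t where t: "t \<in> I" "?X1 t = ?X2 t" by auto
  \<comment> \<open>All times in \<open>I\<close> are at most \<open>\<tau>\<close>, so a meeting time can only be \<open>\<tau>\<close> itself.\<close>
  have "\<tau> \<le> ereal t" unfolding inf using t by (intro INF_lower) auto
  then have I: "I = {0..t}" and t0: "0 \<le> t"
    using t(1) by (auto simp: I_def times_upto_def intro: order_trans)
  have bounds: "?X1 r \<le> ?Y r" "?Y r \<le> ?X2 r" if "r \<in> {0..t}" for r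
    using S that unfolding I by auto
  have mono: "l1 r \<le> l1 t" "l2 r \<le> l2 t" if "r \<in> {0..t}" for r
    using S that t0 unfolding I mono_on_def by auto
  have l0: "0 \<le> l1 t" "0 \<le> l2 t" using mono[of 0] S t0 by auto
  have cV: "continuous_on {0..t} ?V"
    unfolding path_V_def using S unfolding I by (intro continuous_intros) auto
  obtain c where c: "\<And>r. r \<in> {0..t} \<Longrightarrow> \<bar>?V r\<bar> \<le> c"
  proof -
    have "bounded (?V ` {0..t})"
      by (intro compact_imp_bounded compact_continuous_image cV) simp
    then obtain a where "\<forall>z\<in>?V ` {0..t}. norm z \<le> a" unfolding bounded_iff by blast
    then show ?thesis by (intro that[of a]) auto
  qed
  define C where "C = nat \<lceil>c\<rceil>"
  have cC: "c \<le> real C" unfolding C_def by linarith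
  have lip: "\<bar>?Y t - ?Y r\<bar> \<le> C * (t - r)" if r: "r \<in> {0..t}" for r
  proof -
    have int: "?V integrable_on {0..t}" by (rule integrable_continuous_interval[OF cV])
    have "integral {0..r} ?V + integral {r..t} ?V = integral {0..t} ?V"
      using r by (intro Henstock_Kurzweil_Integration.integral_combine int) auto
    then have "?Y t - ?Y r = integral {r..t} ?V" by (simp add: path_Y_def)
    also have "norm \<dots> \<le> C * (t - r)"
      using r cV c cC
      by (intro integral_bound) (auto intro: continuous_on_subset order_trans)
    finally show ?thesis by simp
  qed
  have Y0: "?Y 0 = y" by (simp add: path_Y_def)
  have eq: "b1 t = ?Y t + l1 t" "b2 t = ?Y t - x - l2 t"
    using bounds[of t] t(2) t0 by (simp_all add: path_X1_def path_X2_def)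
  have "simultaneous_record (real C) (y, x - y) b1 b2 t"
    unfolding simultaneous_record_def
  proof (intro conjI ballI)
    show "fst (y, x - y) \<le> b1 t + real C * t" "snd (y, x - y) \<le> real C * t - b2 t"
      using lip[of 0] t0 l0 unfolding Y0 eq by (auto simp: abs_le_iff)
    fix r assume r: "r \<in> {0..t}"
    have "b1 r \<le> ?Y r + l1 t" "?Y r - x - l2 t \<le> b2 r"
      using bounds[OF r] mono[OF r] by (auto simp: path_X1_def path_X2_def)
    then show "b1 r + real C * r \<le> b1 t + real C * t" "real C * r - b2 r \<le> real C * t - b2 t"
      using lip[OF r] unfolding eq by (auto simp: abs_le_iff algebra_simps)
  qed
  with t0 show ?thesis by blast
qed

theorem theorem4p4:
  fixes M :: "'a measure"
    and B1 B2 L1 L2 :: "real \<Rightarrow> 'a \<Rightarrow> real"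
    and T :: "'a \<Rightarrow> ereal"
    and x y v K :: real
  assumes "prob_space M"
    and "prob_space.brownian_motion M B1"
    and "prob_space.brownian_motion M B2"
    and "prob_space.indep_processes M B1 B2"
    and "0 < x" and "0 \<le> y" and "y \<le> x" and "0 < K"
    and "T \<in> borel_measurable M"
    and "AE \<omega> in M. path_solution x y v K
           (\<lambda>t. B1 t \<omega>) (\<lambda>t. B2 t \<omega>) (\<lambda>t. L1 t \<omega>) (\<lambda>t. L2 t \<omega>) (T \<omega>)"
  shows "measure M {\<omega> \<in> space M. T \<omega> = \<infinity>} = 1"
proof -
  interpret prob_space M by fact
  have "AE \<omega> in M. \<forall>C n :: nat. \<forall>t\<in>{0..real (Suc n)}.
      \<not> simultaneous_record (real C) (y, x - y) (\<lambda>t. B1 t \<omega>) (\<lambda>t. B2 t \<omega>) t"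
    unfolding AE_all_countable
    using AE_no_simultaneous_record[OF assms(2-4)] assms(5-7) by simp
  with assms(10) have "AE \<omega> in M. T \<omega> = \<infinity>"
  proof eventually_elim
    case (elim \<omega>)
    show ?case
    proof (rule ccontr)
      assume "T \<omega> \<noteq> \<infinity>"
      then obtain C t where t: "0 \<le> t"
        "simultaneous_record (real C) (y, x - y) (\<lambda>t. B1 t \<omega>) (\<lambda>t. B2 t \<omega>) t"
        using simultaneous_record_of_collision[OF elim(1)] by blast
      have "t \<in> {0..real (Suc (nat \<lceil>t\<rceil>))}" using t(1) by simp linarith
      with t(2) elim(2) show False by blast
    qed
  qed
  moreover have "{\<omega> \<in> space M. T \<omega> = \<infinity>} \<in> events" using assms(9) by measurable
  ultimately show ?thesis by (subst prob_Collect_eq_1) auto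
qed

end
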